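(* Suppose that $\kappa$ is weakly compact. Up to homeomorphism, the generalized Cantor space ${}^{\kappa}2$ is the unique nonempty $\kappa$-additive perfect (equivalently, $\kappa$-perfect) $\kappa$-Lindelöf $\mathrm{SC}_\kappa$-space.
   Context: Work in ZFC; $\kappa$ is an uncountable regular cardinal with $2^{<\kappa}=\kappa$ (equivalently $\kappa^{<\kappa}=\kappa$). "Space" means regular Hausdorff topological space. $\kappa$ is weakly compact if it is strongly inaccessible and every tree $T\subseteq{}^{<\kappa}\kappa$ (set closed under initial segments) all of whose levels $T\cap{}^{\alpha}\kappa$, $\alpha<\kappa$, are nonempty and of size $<\kappa$ has a branch of length $\kappa$. ${}^{\kappa}2$ is the set of all functions $\kappa\to 2$ with the bounded topology, generated by the sets $\{x\in{}^{\kappa}2 \mid s\subseteq x\}$, $s\in{}^{<\kappa}2$. A space is $\kappa$-additive if its topology is closed under intersections of fewer than $\kappa$ open sets. It is perfect if it has no isolated points, and $\kappa$-perfect if no singleton is an intersection of fewer than $\kappa$ open sets (the two notions coincide for $\kappa$-additive spaces). It is $\kappa$-Lindelöf if every open cover has a subcover of size $<\kappa$. Strong $\kappa$-Choquet game $\mathrm{G}^s_\kappa(X)$: players I and II play $\kappa$-many rounds. In round $\alpha<\kappa$, I plays $(U_\alpha,x_\alpha)$ with $U_\alpha$ a relatively open subset of $\bigcap_{\beta<\alpha}V_\beta$ (which is $X$ if $\alpha=0$) and $x_\alpha\in U_\alpha$; then II plays a relatively open subset $V_\alpha$ of $\bigcap_{\beta<\alpha}V_\beta$ with $x_\alpha\in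 V_\alpha\subseteq U_\alpha$. II wins iff $\bigcap_{\alpha<\gamma}V_\alpha\ne\emptyset$ for every limit $\gamma\le\kappa$ (I wins as soon as such an intersection is empty). $X$ is an $\mathrm{SC}_\kappa$-space if it has weight $\le\kappa$ and II has a winning strategy in $\mathrm{G}^s_\kappa(X)$. *)

theory Defs
  imports "HOL-Analysis.Analysis"
begin

unbundle cardinal_syntax

(* An infinite cardinal \<kappa> is a relation with Card_order \<kappa>.  The ordinals \<alpha> < \<kappa> are the
   elements of Field \<kappa>, the ordinal \<alpha> as a set is underS \<kappa> \<alpha>, and the ordinals \<gamma> \<le> \<kappa>
   are the initial segments of Field \<kappa> (the sets D with ofilter \<kappa> D): either underS \<kappa> \<gamma>
   with \<gamma> < \<kappa>, or Field \<kappa> itself. *)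

section \<open>Sequences, trees and weakly compact cardinals\<close>

(* Functions from D to A are partial maps with domain exactly D.  A sequence then determines
   its length, and \<subseteq>\<^sub>m is end-extension. *)
definition sequences :: "'k set \<Rightarrow> 'b set \<Rightarrow> ('k \<rightharpoonup> 'b) set" where
  "sequences D A = {s. dom s = D \<and> ran s \<subseteq> A}"

definition short_sequences :: "'k rel \<Rightarrow> 'b set \<Rightarrow> ('k \<rightharpoonup> 'b) set" where
  "short_sequences \<kappa> A = (\<Union>\<alpha>\<in>Field \<kappa>. sequences (underS \<kappa> \<alpha>) A)"

definition tree :: "'k rel \<Rightarrow> ('k \<rightharpoonup> 'k) set \<Rightarrow> bool" where
  "tree \<kappa> T \<longleftrightarrow> T \<subseteq> short_sequences \<kappa> (Field \<kappa>) \<and>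
     (\<forall>s\<in>T. \<forall>\<alpha>\<in>Field \<kappa>. underS \<kappa> \<alpha> \<subseteq> dom s \<longrightarrow> s |` underS \<kappa> \<alpha> \<in> T)"

definition tree_level :: "'k rel \<Rightarrow> ('k \<rightharpoonup> 'k) set \<Rightarrow> 'k \<Rightarrow> ('k \<rightharpoonup> 'k) set" where
  "tree_level \<kappa> T \<alpha> = T \<inter> sequences (underS \<kappa> \<alpha>) (Field \<kappa>)"

definition strongly_inaccessible :: "'k rel \<Rightarrow> bool" where
  "strongly_inaccessible \<kappa> \<longleftrightarrow> Card_order \<kappa> \<and> natLeq <o \<kappa> \<and> regularCard \<kappa> \<and>
     (\<forall>\<mu> :: 'k rel. Card_order \<mu> \<and> \<mu> <o \<kappa> \<longrightarrow> ctwo ^c \<mu> <o \<kappa>)"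

definition weakly_compact :: "'k rel \<Rightarrow> bool" where
  "weakly_compact \<kappa> \<longleftrightarrow> strongly_inaccessible \<kappa> \<and>
     (\<forall>T. tree \<kappa> T \<and>
          (\<forall>\<alpha>\<in>Field \<kappa>. tree_level \<kappa> T \<alpha> \<noteq> {} \<and> |tree_level \<kappa> T \<alpha>| <o \<kappa>) \<longrightarrow>
        (\<exists>b \<in> sequences (Field \<kappa>) (Field \<kappa>). \<forall>\<alpha>\<in>Field \<kappa>. b |` underS \<kappa> \<alpha> \<in> T))"

section \<open>Topological notions\<close>

definition generalized_Cantor :: "'k rel \<Rightarrow> ('k \<rightharpoonup> bool) topology" where
  "generalized_Cantor \<kappa> =
     topology_generated_by
       {{x \<in> sequences (Field \<kappa>) UNIV. s \<subseteq>\<^sub>m x} | s. s \<in> short_sequences \<kappa> UNIV}"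

definition kappa_additive :: "'k rel \<Rightarrow> 'a topology \<Rightarrow> bool" where
  "kappa_additive \<kappa> X \<longleftrightarrow>
     (\<forall>\<U>. (\<forall>U\<in>\<U>. openin X U) \<and> |\<U>| <o \<kappa> \<longrightarrow> openin X (topspace X \<inter> \<Inter>\<U>))"

definition perfect_space :: "'a topology \<Rightarrow> bool" where
  "perfect_space X \<longleftrightarrow> (\<forall>x\<in>topspace X. \<not> openin X {x})"

definition kappa_perfect :: "'k rel \<Rightarrow> 'a topology \<Rightarrow> bool" where
  "kappa_perfect \<kappa> X \<longleftrightarrow>
     (\<forall>x\<in>topspace X. \<not> (\<exists>\<U>. (\<forall>U\<in>\<U>. openin X U) \<and> |\<U>| <o \<kappa> \<and> topspace X \<inter> \<Inter>\<U> = {x}))"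

definition kappa_Lindelof :: "'k rel \<Rightarrow> 'a topology \<Rightarrow> bool" where
  "kappa_Lindelof \<kappa> X \<longleftrightarrow>
     (\<forall>\<U>. (\<forall>U\<in>\<U>. openin X U) \<and> topspace X \<subseteq> \<Union>\<U> \<longrightarrow>
        (\<exists>\<V>\<subseteq>\<U>. |\<V>| <o \<kappa> \<and> topspace X \<subseteq> \<Union>\<V>))"

definition weight_at_most :: "'k rel \<Rightarrow> 'a topology \<Rightarrow> bool" where
  "weight_at_most \<kappa> X \<longleftrightarrow>
     (\<exists>\<B>. |\<B>| \<le>o \<kappa> \<and> (\<forall>B\<in>\<B>. openin X B) \<and>
        (\<forall>U x. openin X U \<and> x \<in> U \<longrightarrow> (\<exists>B\<in>\<B>. x \<in> B \<and> B \<subseteq> U)))"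

section \<open>The strong Choquet game of length \<open>\<kappa>\<close>\<close>

(* The intersection of the moves V \<beta>, \<beta> \<in> D, read as the whole space if D = {}. *)
definition moves_Inter :: "'a topology \<Rightarrow> ('k \<Rightarrow> 'a set) \<Rightarrow> 'k set \<Rightarrow> 'a set" where
  "moves_Inter X V D = topspace X \<inter> (\<Inter>\<beta>\<in>D. V \<beta>)"

definition legal_I ::
  "'k rel \<Rightarrow> 'a topology \<Rightarrow> ('k \<Rightarrow> 'a set) \<Rightarrow> ('k \<Rightarrow> 'a) \<Rightarrow> ('k \<Rightarrow> 'a set) \<Rightarrow> 'k \<Rightarrow> bool" where
  "legal_I \<kappa> X U x V \<alpha> \<longleftrightarrow>
     openin (subtopology X (moves_Inter X V (underS \<kappa> \<alpha>))) (U \<alpha>) \<and> x \<alpha> \<in> U \<alpha>"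

definition legal_II ::
  "'k rel \<Rightarrow> 'a topology \<Rightarrow> ('k \<Rightarrow> 'a set) \<Rightarrow> ('k \<Rightarrow> 'a) \<Rightarrow> ('k \<Rightarrow> 'a set) \<Rightarrow> 'k \<Rightarrow> bool" where
  "legal_II \<kappa> X U x V \<alpha> \<longleftrightarrow>
     openin (subtopology X (moves_Inter X V (underS \<kappa> \<alpha>))) (V \<alpha>) \<and>
     x \<alpha> \<in> V \<alpha> \<and> V \<alpha> \<subseteq> U \<alpha>"

(* A strategy for II maps the round \<alpha>, I's moves up to and including round \<alpha>, and II's own
   earlier moves to II's move in round \<alpha>. *)
type_synonym ('k, 'a) strategy_II =
  "'k \<Rightarrow> ('k \<Rightarrow> 'a set) \<Rightarrow> ('k \<Rightarrow> 'a) \<Rightarrow> ('k \<Rightarrow> 'a set) \<Rightarrow> 'a set"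

definition follows ::
  "'k rel \<Rightarrow> ('k, 'a) strategy_II \<Rightarrow> ('k \<Rightarrow> 'a set) \<Rightarrow> ('k \<Rightarrow> 'a) \<Rightarrow> ('k \<Rightarrow> 'a set) \<Rightarrow> 'k \<Rightarrow> bool"
  where
  "follows \<kappa> \<sigma> U x V \<alpha> \<longleftrightarrow>
     V \<alpha> = \<sigma> \<alpha> (restrict U (under \<kappa> \<alpha>)) (restrict x (under \<kappa> \<alpha>)) (restrict V (underS \<kappa> \<alpha>))"

definition limit_ordinal :: "'k rel \<Rightarrow> 'k set \<Rightarrow> bool" where
  "limit_ordinal \<kappa> D \<longleftrightarrow> ofilter \<kappa> D \<and> D \<noteq> {} \<and> (\<forall>\<alpha>\<in>D. \<exists>\<beta>\<in>D. \<alpha> \<in> underS \<kappa> \<beta>)"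

(* D is the length of a partial play.  All lengths \<le> \<kappa> are considered, because a play stops at
   a limit \<gamma> < \<kappa> when the intersection is empty: I has no legal move there, yet I has won. *)
definition winning_strategy_II :: "'k rel \<Rightarrow> 'a topology \<Rightarrow> ('k, 'a) strategy_II \<Rightarrow> bool" where
  "winning_strategy_II \<kappa> X \<sigma> \<longleftrightarrow>
     (\<forall>U x V D. ofilter \<kappa> D \<and> (\<forall>\<alpha>\<in>D. legal_I \<kappa> X U x V \<alpha> \<and> follows \<kappa> \<sigma> U x V \<alpha>) \<longrightarrow>
        (\<forall>\<alpha>\<in>D. legal_II \<kappa> X U x V \<alpha>) \<and>
        (limit_ordinal \<kappa> D \<longrightarrow> moves_Inter X V D \<noteq> {}))"

definition SC_space :: "'k rel \<Rightarrow> 'a topology \<Rightarrow> bool" where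
  "SC_space \<kappa> X \<longleftrightarrow> weight_at_most \<kappa> X \<and> (\<exists>\<sigma>. winning_strategy_II \<kappa> X \<sigma>)"

end

theory Submission
  imports Defs
begin

text \<open>
  The space \<open>2\<^sup>\<kappa>\<close> is handled through its \<^emph>\<open>cylinders\<close> \<open>N\<^sub>s = {x. s \<subseteq> x}\<close>, where \<open>s\<close> is a binary
  sequence of length \<open>< \<kappa>\<close>. Two facts about them do most of the work: fewer than \<open>\<kappa>\<close> cylinders
  with a common point intersect in a cylinder (\<open>Inter_cylinders\<close>, by regularity of \<open>\<kappa>\<close>), and
  any family of pairwise intersecting cylinders has a common point
  (\<open>Inter_cylinders_nonempty\<close>, because the stems fit together). The first gives additivity; the
  second shows that II wins the strong Choquet game by always answering with a cylinder. The
  \<open>\<kappa>\<close>-Lindelof property is the tree property: if an open cover had no small subcover, the stems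
  whose cylinders are contained in no member of the cover would form a tree with nonempty levels
  of size \<open>< \<kappa>\<close>, and a branch through it would be an uncovered point (\<open>Lindelof_Cantor\<close>).

  For uniqueness, let \<open>X\<close> be a space with the listed properties and \<open>\<sigma>\<close> a winning strategy of II.
  Countable intersections of open sets are open, so \<open>X\<close> has a base \<open>(B\<^sub>\<alpha>)\<close>, \<open>\<alpha> < \<kappa>\<close>, of clopen
  sets (\<open>clopen_base\<close>), and every clopen set can be partitioned, finely with respect to any
  prescribed neighbourhoods, into fewer than \<open>\<kappa>\<close> clopen pieces (\<open>small_clopen_partition\<close>).
  Along the ordinals \<open>\<alpha> < \<kappa>\<close> one builds finer and finer partitions of \<open>X\<close> into clopen \<^emph>\<open>cells\<close>
  and, in step with them, partitions of \<open>2\<^sup>\<kappa>\<close> into cylinders. Suppose that \<open>C\<close> is the intersection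
  of a chain of earlier cells and \<open>N\<close> the intersection of the corresponding cylinders. For each
  \<open>x \<in> C\<close>, player I may offer \<open>(C, x)\<close> and II answers with an open set \<open>V\<^sub>x\<close>. Partition \<open>C\<close> into at
  least two and fewer than \<open>\<kappa>\<close> clopen pieces, each contained in some \<open>V\<^sub>x\<close> and each decided by
  \<open>B\<^sub>\<alpha>\<close>, that is, contained in it or disjoint from it. The cylinder \<open>N\<close> can be split into exactly as
  many cylinders with longer stems (\<open>cylinder_split\<close>), and any bijection between the two
  partitions will do.

  The cells along a chain are interleaved with the answers of II in a play that follows \<open>\<sigma>\<close>; hence
  at every limit stage, and also after all \<open>\<kappa>\<close> stages, their intersection is nonempty
  (\<open>history_cells_meet\<close>). So the chains of cells correspond to the chains of cylinders. At the
  end a chain of cells has exactly one point, since the base sets separate points, and a chain of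
  cylinders has exactly one point, since the stems grow. Matching these points defines a bijection
  \<open>X \<rightarrow> 2\<^sup>\<kappa>\<close> (\<open>code\<close>) which maps cells onto cylinders, and is therefore a homeomorphism
  (\<open>homeomorphic_Cantor\<close>).
\<close>

section \<open>Regular uncountable cardinals\<close>

lemma openin_kappa_Inter:
  assumes "kappa_additive \<kappa> X" "|I| <o \<kappa>" "\<And>i. i \<in> I \<Longrightarrow> openin X (U i)"
  shows "openin X (topspace X \<inter> (\<Inter>i\<in>I. U i))"
proof -
  have "|U ` I| <o \<kappa>"
    by (rule ordLeq_ordLess_trans[OF card_of_image assms(2)])
  then show ?thesis
    using assms(1,3) unfolding kappa_additive_def by auto
qed

locale regular_cardinal =
  fixes \<kappa> :: "'k rel"
  assumes Card_order: "Card_order \<kappa>"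
    and uncountable: "natLeq <o \<kappa>"
    and regular: "regularCard \<kappa>"
begin

lemma wo: "wo_rel \<kappa>"
  using Card_order by (simp add: wo_rel_def card_order_on_def)

lemma Cinfinite: "Cinfinite \<kappa>"
  using cinfinite_mono[OF ordLess_imp_ordLeq[OF uncountable] natLeq_cinfinite] Card_order by simp

lemma infinite_Field: "infinite (Field \<kappa>)"
  using Cinfinite by (simp add: cinfinite_def)

lemma finite_less: "finite A \<Longrightarrow> |A| <o \<kappa>"
  by (rule ordLess_transitive[OF iffD1[OF finite_iff_ordLess_natLeq] uncountable])

lemma underS_less: "a \<in> Field \<kappa> \<Longrightarrow> |underS \<kappa> a| <o \<kappa>"
  by (rule card_of_underS[OF Card_order])

lemma Field_not_less: "\<not> |Field \<kappa>| <o \<kappa>"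
  using card_of_Field_ordIso[OF Card_order] not_ordLess_ordIso by auto

lemma not_less_iff: "\<not> |A| <o \<kappa> \<longleftrightarrow> \<kappa> \<le>o |A|"
  using not_ordLess_iff_ordLeq[OF wo_rel.WELL[OF wo] card_of_Well_order[of A]]
    not_ordLess_iff_ordLeq[OF card_of_Well_order[of A] wo_rel.WELL[OF wo]] by simp

lemma under_eq: "a \<in> Field \<kappa> \<Longrightarrow> under \<kappa> a = insert a (underS \<kappa> a)"
  using wo_rel.REFL[OF wo] by (auto simp: under_def underS_def refl_on_def)

lemma underS_Field: "underS \<kappa> a \<subseteq> Field \<kappa>"
  by (auto simp: underS_def Field_def)

lemma underS_cases:
  assumes "a \<in> Field \<kappa>" "b \<in> Field \<kappa>"
  obtains "a \<in> underS \<kappa> b" | "a = b" | "b \<in> underS \<kappa> a"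
  using wo_rel.TOTALS[OF wo] assms by (auto simp: underS_def)

lemma underS_trans: "a \<in> underS \<kappa> b \<Longrightarrow> b \<in> underS \<kappa> c \<Longrightarrow> a \<in> underS \<kappa> c"
  using wo_rel.TRANS[OF wo] wo_rel.ANTISYM[OF wo]
  by (auto simp: underS_def trans_def antisym_def)

lemma underS_irrefl: "a \<notin> underS \<kappa> a"
  by (simp add: underS_def)

lemma ofilter_underS: "ofilter \<kappa> (underS \<kappa> a)"
  by (rule wo_rel.underS_ofilter[OF wo])

lemma ofilter_under: "ofilter \<kappa> (under \<kappa> a)"
  by (rule wo_rel.under_ofilter[OF wo])

lemma ofilter_Field: "ofilter \<kappa> (Field \<kappa>)"
  by (rule wo_rel.Field_ofilter[OF wo])

lemma ofilter_closed: "ofilter \<kappa> D \<Longrightarrow> b \<in> D \<Longrightarrow> a \<in> underS \<kappa> b \<Longrightarrow> a \<in> D"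
  by (auto simp: ofilter_def under_def underS_def)

lemma ordinal_induct [consumes 1, case_names less]:
  assumes "a \<in> Field \<kappa>"
    and step: "\<And>a. a \<in> Field \<kappa> \<Longrightarrow> (\<And>b. b \<in> underS \<kappa> a \<Longrightarrow> P b) \<Longrightarrow> P a"
  shows "P a"
proof -
  have "a \<in> Field \<kappa> \<longrightarrow> P a"
  proof (rule wo_rel.well_order_induct[OF wo, where P = "\<lambda>a. a \<in> Field \<kappa> \<longrightarrow> P a"], rule impI)
    fix x assume IH: "\<forall>y. y \<noteq> x \<and> (y, x) \<in> \<kappa> \<longrightarrow> y \<in> Field \<kappa> \<longrightarrow> P y" and x: "x \<in> Field \<kappa>"
    show "P x"
    proof (rule step[OF x])
      fix b assume "b \<in> underS \<kappa> x"
      then show "P b" using IH underS_Field[of x] by (auto simp: underS_def)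
    qed
  qed
  then show ?thesis using assms(1) by blast
qed

lemma least_ordinal:
  assumes "i \<in> S" "S \<subseteq> Field \<kappa>"
  obtains j where "j \<in> S" "\<And>k. k \<in> underS \<kappa> j \<Longrightarrow> k \<notin> S"
proof (rule ccontr)
  assume neg: "\<not> thesis"
  have "i \<in> Field \<kappa>" using assms by blast
  then have "i \<notin> S"
  proof (induction rule: ordinal_induct)
    case (less a)
    then show ?case using neg that by metis
  qed
  then show False using assms(1) by blast
qed

lemma under_eq_underS:
  assumes "a \<in> Field \<kappa>"
  obtains b where "b \<in> Field \<kappa>" "under \<kappa> a = underS \<kappa> b"
proof -
  have "under \<kappa> a \<noteq> Field \<kappa>"
    using Card_order_infinite_not_under[OF Card_order infinite_Field] by metis
  then show ?thesis
    using wo_rel.ofilter_underS_Field[OF wo, of "under \<kappa> a"] ofilter_under that by metis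
qed

lemma underS_step:
  assumes "a \<in> Field \<kappa>"
  obtains b where "b \<in> Field \<kappa>" "a \<in> underS \<kappa> b"
proof -
  obtain b where "b \<in> Field \<kappa>" "a \<noteq> b" "(a, b) \<in> \<kappa>"
    using infinite_Card_order_limit[OF Card_order infinite_Field assms] by blast
  then show ?thesis using that by (simp add: underS_def)
qed

text \<open>The form in which regularity is used: a union of fewer than \<open>\<kappa>\<close> proper initial segments has
  fewer than \<open>\<kappa>\<close> elements, so it is again a proper initial segment.\<close>

lemma UN_underS_bounded:
  assumes "|I| <o \<kappa>" "\<And>i. i \<in> I \<Longrightarrow> a i \<in> Field \<kappa>"
  obtains b where "b \<in> Field \<kappa>" "(\<Union>i\<in>I. underS \<kappa> (a i)) = underS \<kappa> b"
proof -
  let ?D = "\<Union>i\<in>I. underS \<kappa> (a i)"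
  have "ofilter \<kappa> ?D"
    by (rule wo_rel.ofilter_UNION[OF wo]) (simp add: ofilter_underS)
  moreover have "|?D| <o \<kappa>"
    by (rule card_of_UNION_ordLess_infinite_Field_regularCard[OF regular Cinfinite assms(1)])
      (use assms(2) underS_less in auto)
  then have "?D \<noteq> Field \<kappa>"
    using Field_not_less by auto
  ultimately have "\<exists>b\<in>Field \<kappa>. ?D = underS \<kappa> b"
    using wo_rel.ofilter_underS_Field[OF wo, of ?D] by auto
  then show ?thesis using that by auto
qed

text \<open>Intervals replace ordinal addition. Removing the small set \<open>underS \<kappa> a\<close> leaves \<open>\<kappa>\<close> many
  ordinals, so the order type of the remainder exceeds the initial ordinal of \<open>|Q|\<close>, which is
  therefore realized by some interval \<open>[a, b)\<close>.\<close>

lemma small_set_as_interval: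
  assumes a: "a \<in> Field \<kappa>" and Q: "|Q| <o \<kappa>"
  obtains b f where "b \<in> Field \<kappa>" "a = b \<or> a \<in> underS \<kappa> b"
    "bij_betw f Q (underS \<kappa> b - underS \<kappa> a)"
proof -
  let ?A = "Field \<kappa> - underS \<kappa> a"
  let ?r = "Restr \<kappa> ?A"
  have wor: "well_order_on ?A ?r"
    by (rule well_order_on_Restr[OF wo_rel.WELL[OF wo] Diff_subset])
  have F: "Field ?r = ?A" by (rule well_order_on_Field[OF wor, symmetric])
  have WR: "Well_order ?r" by (rule Well_order_Restr[OF wo_rel.WELL[OF wo]])
  have "\<not> |?A| <o \<kappa>"
  proof
    assume "|?A| <o \<kappa>"
    then have "|?A \<union> underS \<kappa> a| <o \<kappa>"
      using card_of_Un_ordLess_infinite_Field[OF infinite_Field Card_order] underS_less[OF a] by blast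
    moreover have "?A \<union> underS \<kappa> a = Field \<kappa>" using underS_Field by blast
    ultimately show False using Field_not_less by simp
  qed
  then have "\<kappa> \<le>o |?A|"
    using not_less_iff by blast
  from ordLess_ordLeq_trans[OF ordLess_ordLeq_trans[OF Q this] card_of_least[OF wor]]
  have "|Q| <o ?r" .
  then obtain b where b: "b \<in> Field ?r" "|Q| =o Restr ?r (underS ?r b)"
    using ordLess_iff_ordIso_Restr[OF WR card_of_Well_order] by blast
  have u: "underS ?r b = underS \<kappa> b - underS \<kappa> a"
    using b(1) F underS_Field[of b] by (auto simp: underS_def)
  have "Field (Restr ?r (underS ?r b)) = underS ?r b"
    by (rule Field_Restr_ofilter[OF WR]) (use WR in \<open>simp add: wo_rel.underS_ofilter wo_rel_def\<close>)
  then have "|Q| =o |underS \<kappa> b - underS \<kappa> a|"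
    using card_of_cong[OF b(2)] u by (simp add: Field_card_of)
  then obtain f where "bij_betw f Q (underS \<kappa> b - underS \<kappa> a)" using card_of_ordIso by blast
  moreover have "b \<in> Field \<kappa>" using b F by blast
  moreover have "a = b \<or> a \<in> underS \<kappa> b"
    using b F a \<open>b \<in> Field \<kappa>\<close> underS_cases[of a b] by auto
  ultimately show ?thesis using that by blast
qed

end

section \<open>Cylinders and the topology of the generalized Cantor space\<close>

definition cylinder :: "'k rel \<Rightarrow> ('k \<rightharpoonup> bool) \<Rightarrow> ('k \<rightharpoonup> bool) set" where
  "cylinder \<kappa> s = {x \<in> sequences (Field \<kappa>) UNIV. s \<subseteq>\<^sub>m x}"

definition cylinders :: "'k rel \<Rightarrow> ('k \<rightharpoonup> bool) set set" where
  "cylinders \<kappa> = cylinder \<kappa> ` short_sequences \<kappa> UNIV"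

lemma mem_sequences_UNIV: "s \<in> sequences D UNIV \<longleftrightarrow> dom s = D"
  by (simp add: sequences_def)

lemma mem_cylinder: "x \<in> cylinder \<kappa> s \<longleftrightarrow> dom x = Field \<kappa> \<and> s \<subseteq>\<^sub>m x"
  by (simp add: cylinder_def mem_sequences_UNIV)

lemma cylinder_antimono: "s \<subseteq>\<^sub>m t \<Longrightarrow> cylinder \<kappa> t \<subseteq> cylinder \<kappa> s"
  using map_le_trans by (auto simp: mem_cylinder)

context regular_cardinal
begin

abbreviation points :: "('k \<rightharpoonup> bool) set" where
  "points \<equiv> sequences (Field \<kappa>) UNIV"

lemma cylinders_subset_points: "N \<in> cylinders \<kappa> \<Longrightarrow> N \<subseteq> points"
  by (auto simp: cylinders_def cylinder_def)

lemma mem_cylinder_restrict: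
  assumes "w \<in> points"
  shows "x \<in> cylinder \<kappa> (w |` D) \<longleftrightarrow> x \<in> points \<and> (\<forall>i\<in>D. x i = w i)"
proof -
  have "w |` D \<subseteq>\<^sub>m x \<longleftrightarrow> (\<forall>i\<in>D. x i = w i)" if x: "dom x = Field \<kappa>"
  proof -
    have eq: "dom x = dom w" using x assms by (simp add: mem_sequences_UNIV)
    have "x i = w i" if "i \<notin> dom w" for i using that eq by (metis domIff)
    then show ?thesis 
      by (simp add: map_le_def restrict_map_def dom_def) (metis option.exhaust)
  qed
  then show ?thesis by (auto simp: mem_cylinder mem_sequences_UNIV)
qed

lemma cylinder_restrict_in_cylinders:
  assumes "w \<in> points" "a \<in> Field \<kappa>"
  shows "cylinder \<kappa> (w |` underS \<kappa> a) \<in> cylinders \<kappa>"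
  using assms underS_Field[of a]
  by (auto simp: cylinders_def short_sequences_def mem_sequences_UNIV intro!: imageI bexI[of _ a])

lemma cylinders_cases:
  assumes "N \<in> cylinders \<kappa>" "w \<in> N"
  obtains a where "a \<in> Field \<kappa>" "N = cylinder \<kappa> (w |` underS \<kappa> a)"
proof -
  obtain s a where s: "a \<in> Field \<kappa>" "dom s = underS \<kappa> a" "N = cylinder \<kappa> s"
    using assms(1) by (auto simp: cylinders_def short_sequences_def mem_sequences_UNIV)
  have "s = w |` underS \<kappa> a"
    using assms(2) s by (auto simp: mem_cylinder map_le_def restrict_map_def fun_eq_iff dom_def)
  then show ?thesis using that s by blast
qed

lemma points_extend:
  assumes "dom s \<subseteq> Field \<kappa>"
  shows "(\<lambda>i. if i \<in> Field \<kappa> then (if i \<in> dom s then s i else Some v) else None) \<in> cylinder \<kappa> s"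
  using assms by (auto simp: mem_cylinder map_le_def split: if_splits)

lemma cylinder_nonempty: "N \<in> cylinders \<kappa> \<Longrightarrow> N \<noteq> {}"
proof -
  assume "N \<in> cylinders \<kappa>"
  then obtain s a where "a \<in> Field \<kappa>" "dom s = underS \<kappa> a" "N = cylinder \<kappa> s"
    by (auto simp: cylinders_def short_sequences_def mem_sequences_UNIV)
  then show ?thesis using points_extend[of s True] underS_Field[of a] by blast
qed

lemma points_in_cylinders: "points \<in> cylinders \<kappa>"
proof -
  have "|{} :: 'k set| <o \<kappa>" by (rule finite_less) simp
  then obtain a where a: "a \<in> Field \<kappa>" "(\<Union>i\<in>{} :: 'k set. underS \<kappa> (id i)) = underS \<kappa> a"
    by (rule UN_underS_bounded[where a = id]) simp
  have "points = cylinder \<kappa> Map.empty"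
    by (auto simp: mem_cylinder mem_sequences_UNIV)
  moreover have "Map.empty \<in> short_sequences \<kappa> UNIV"
    using a by (auto simp: short_sequences_def mem_sequences_UNIV)
  ultimately show ?thesis unfolding cylinders_def by (metis imageI)
qed

text \<open>Each of the cylinders is given by an initial segment of the common point \<open>w\<close>. The lengths of
  these segments are bounded, and the intersection is given by their union.\<close>

lemma Inter_cylinders:
  assumes small: "|\<N>| <o \<kappa>" and cylinders: "\<N> \<subseteq> cylinders \<kappa>" and w: "w \<in> points" "\<And>N. N \<in> \<N> \<Longrightarrow> w \<in> N"
  shows "points \<inter> \<Inter>\<N> \<in> cylinders \<kappa>"
proof -
  have "\<forall>N\<in>\<N>. \<exists>a. a \<in> Field \<kappa> \<and> N = cylinder \<kappa> (w |` underS \<kappa> a)"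
    using cylinders w(2) cylinders_cases by (metis subsetD)
  then obtain a where a: "\<And>N. N \<in> \<N> \<Longrightarrow> a N \<in> Field \<kappa>"
      "\<And>N. N \<in> \<N> \<Longrightarrow> N = cylinder \<kappa> (w |` underS \<kappa> (a N))"
    by metis
  obtain b where b: "b \<in> Field \<kappa>" "(\<Union>N\<in>\<N>. underS \<kappa> (a N)) = underS \<kappa> b"
    using UN_underS_bounded[OF small, of a] a(1) by blast
  have "x \<in> points \<inter> \<Inter>\<N> \<longleftrightarrow> x \<in> cylinder \<kappa> (w |` underS \<kappa> b)" for x
  proof -
    have "x \<in> N \<longleftrightarrow> x \<in> points \<and> (\<forall>i\<in>underS \<kappa> (a N). x i = w i)" if "N \<in> \<N>" for N
      using a(2)[OF that] mem_cylinder_restrict[OF w(1)] by metis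
    then have "x \<in> points \<inter> \<Inter>\<N> \<longleftrightarrow> x \<in> points \<and> (\<forall>i\<in>(\<Union>N\<in>\<N>. underS \<kappa> (a N)). x i = w i)"
      by auto
    then show ?thesis using b(2) mem_cylinder_restrict[OF w(1)] by simp
  qed
  then have "points \<inter> \<Inter>\<N> = cylinder \<kappa> (w |` underS \<kappa> b)" by blast
  then show ?thesis using cylinder_restrict_in_cylinders[OF w(1) b(1)] by simp
qed

text \<open>Stems of intersecting cylinders agree where both are defined, so the union of all stems is a
  function, of length at most \<open>\<kappa>\<close>, and any total extension of it is a common point.\<close>

lemma Inter_cylinders_nonempty:
  assumes cylinders: "\<N> \<subseteq> cylinders \<kappa>" and meet: "\<And>M N. M \<in> \<N> \<Longrightarrow> N \<in> \<N> \<Longrightarrow> M \<inter> N \<noteq> {}"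
  obtains w where "w \<in> points" "\<And>N. N \<in> \<N> \<Longrightarrow> w \<in> N"
proof -
  have "\<exists>s. N = cylinder \<kappa> s \<and> dom s \<subseteq> Field \<kappa>" if N: "N \<in> \<N>" for N
  proof -
    obtain s a where "dom s = underS \<kappa> a" "N = cylinder \<kappa> s"
      using N cylinders by (auto simp: cylinders_def short_sequences_def mem_sequences_UNIV)
    then show ?thesis using underS_Field[of a] by blast
  qed
  then obtain s where s: "\<And>N. N \<in> \<N> \<Longrightarrow> N = cylinder \<kappa> (s N)" "\<And>N. N \<in> \<N> \<Longrightarrow> dom (s N) \<subseteq> Field \<kappa>"
    by metis
  \<comment> \<open>the union of the stems, extended by \<open>False\<close>\<close>
  define w where "w i = (if i \<in> Field \<kappa> then Some (\<exists>N\<in>\<N>. s N i = Some True) else None)" for i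
  have w: "w \<in> points" by (auto simp: mem_sequences_UNIV w_def split: if_splits)
  have "w \<in> N" if N: "N \<in> \<N>" for N
  proof -
    have "s N i = w i" if i: "i \<in> dom (s N)" for i
    proof -
      obtain v where v: "s N i = Some v" using i by blast
      have "v" if M: "M \<in> \<N>" "s M i = Some True" for M
      proof -
        obtain x where "x \<in> M" "x \<in> N" using meet[OF M(1) N] by blast
        then have "s M \<subseteq>\<^sub>m x" "s N \<subseteq>\<^sub>m x" using s(1) N M(1) mem_cylinder by metis+
        then show ?thesis using v M(2) by (metis domI map_le_def option.inject)
      qed
      then show ?thesis using v N i s(2)[OF N] by (auto simp: w_def)
    qed
    then show ?thesis using s(1)[OF N] w by (auto simp: mem_cylinder map_le_def mem_sequences_UNIV)
  qed
  then show ?thesis using that w by blast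
qed

lemma Int_cylinders:
  assumes "M \<in> cylinders \<kappa>" "N \<in> cylinders \<kappa>" "w \<in> M" "w \<in> N"
  shows "M \<inter> N \<in> cylinders \<kappa>"
proof -
  have "|{M, N}| <o \<kappa>" by (rule finite_less) simp
  then have "points \<inter> \<Inter>{M, N} \<in> cylinders \<kappa>"
    by (rule Inter_cylinders[where w = w]) (use assms cylinders_subset_points in auto)
  moreover have "points \<inter> \<Inter>{M, N} = M \<inter> N" using assms cylinders_subset_points by auto
  ultimately show ?thesis by simp
qed

lemma generalized_Cantor_eq: "generalized_Cantor \<kappa> = topology_generated_by (cylinders \<kappa>)"
  unfolding generalized_Cantor_def cylinders_def cylinder_def
  by (rule arg_cong[where f = topology_generated_by]) auto

lemma openin_Cantor:
  "openin (generalized_Cantor \<kappa>) U \<longleftrightarrow>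
     U \<subseteq> points \<and> (\<forall>w\<in>U. \<exists>N\<in>cylinders \<kappa>. w \<in> N \<and> N \<subseteq> U)"
proof
  assume "openin (generalized_Cantor \<kappa>) U"
  then have "generate_topology_on (cylinders \<kappa>) U"
    by (simp add: generalized_Cantor_eq openin_topology_generated_by_iff)
  then show "U \<subseteq> points \<and> (\<forall>w\<in>U. \<exists>N\<in>cylinders \<kappa>. w \<in> N \<and> N \<subseteq> U)"
  proof induction
    case Empty
    then show ?case by blast
  next
    case (Int a b)
    have "\<exists>N\<in>cylinders \<kappa>. w \<in> N \<and> N \<subseteq> a \<inter> b" if "w \<in> a \<inter> b" for w
    proof -
      from that have "w \<in> a" "w \<in> b" by auto
      obtain M where M: "M \<in> cylinders \<kappa>" "w \<in> M" "M \<subseteq> a"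
        using Int.IH(1) \<open>w \<in> a\<close> by auto
      obtain N where N: "N \<in> cylinders \<kappa>" "w \<in> N" "N \<subseteq> b"
        using Int.IH(2) \<open>w \<in> b\<close> by auto
      have "w \<in> M \<inter> N" "M \<inter> N \<subseteq> a \<inter> b" using M N by auto
      with Int_cylinders[OF M(1) N(1) M(2) N(2)] show ?thesis by auto
    qed
    then show ?case using Int.IH by blast
  next
    case (UN K)
    show ?case
    proof (intro conjI ballI)
      show "\<Union>K \<subseteq> points" using UN by (intro Union_least) blast
      fix w assume "w \<in> \<Union>K"
      then obtain k where k: "k \<in> K" "w \<in> k" by blast
      then obtain N where "N \<in> cylinders \<kappa>" "w \<in> N" "N \<subseteq> k" using UN by metis
      then show "\<exists>N\<in>cylinders \<kappa>. w \<in> N \<and> N \<subseteq> \<Union>K" using k(1) by auto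
    qed
  next
    case (Basis s)
    then show ?case using cylinders_subset_points by blast
  qed
next
  assume *: "U \<subseteq> points \<and> (\<forall>w\<in>U. \<exists>N\<in>cylinders \<kappa>. w \<in> N \<and> N \<subseteq> U)"
  then have "U = \<Union>{N \<in> cylinders \<kappa>. N \<subseteq> U}" by blast
  moreover have "openin (generalized_Cantor \<kappa>) (\<Union>{N \<in> cylinders \<kappa>. N \<subseteq> U})"
    by (rule openin_Union) (auto simp: generalized_Cantor_eq topology_generated_by_Basis)
  ultimately show "openin (generalized_Cantor \<kappa>) U" by simp
qed

lemma openin_cylinder: "N \<in> cylinders \<kappa> \<Longrightarrow> openin (generalized_Cantor \<kappa>) N"
  by (simp add: generalized_Cantor_eq topology_generated_by_Basis)

lemma topspace_Cantor: "topspace (generalized_Cantor \<kappa>) = points"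
proof -
  have "openin (generalized_Cantor \<kappa>) points"
    using openin_cylinder[OF points_in_cylinders] .
  moreover have "topspace (generalized_Cantor \<kappa>) \<subseteq> points"
    using openin_topspace[of "generalized_Cantor \<kappa>"] unfolding openin_Cantor by blast
  ultimately show ?thesis using openin_subset by blast
qed

lemma closedin_cylinder:
  assumes "N \<in> cylinders \<kappa>"
  shows "closedin (generalized_Cantor \<kappa>) N"
proof -
  have "openin (generalized_Cantor \<kappa>) (points - N)"
    unfolding openin_Cantor
  proof (intro conjI ballI)
    fix w assume w: "w \<in> points - N"
    obtain v where v: "v \<in> N" using cylinder_nonempty[OF assms] by blast
    obtain a where a: "a \<in> Field \<kappa>" "N = cylinder \<kappa> (v |` underS \<kappa> a)"
      using cylinders_cases[OF assms v] .
    have vp: "v \<in> points" using v cylinders_subset_points assms by blast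
    let ?M = "cylinder \<kappa> (w |` underS \<kappa> a)"
    have "?M \<inter> N = {}"
    proof (rule ccontr)
      assume "?M \<inter> N \<noteq> {}"
      then obtain x where x: "x \<in> ?M" "x \<in> N" by blast
      then have "\<forall>i\<in>underS \<kappa> a. w i = v i"
        using w a(2) vp mem_cylinder_restrict[of w x] mem_cylinder_restrict[of v x] by auto
      then show False using w a(2) mem_cylinder_restrict[OF vp, of w] by auto
    qed
    moreover have "w \<in> ?M" "?M \<in> cylinders \<kappa>"
      using w a mem_cylinder_restrict[of w w] cylinder_restrict_in_cylinders by auto
    ultimately show "\<exists>N'\<in>cylinders \<kappa>. w \<in> N' \<and> N' \<subseteq> points - N"
      using cylinders_subset_points by blast
  qed simp
  then show ?thesis
    using cylinders_subset_points[OF assms] by (simp add: closedin_def topspace_Cantor)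
qed

lemma Cantor_separate:
  assumes "v \<in> points" "w \<in> points" "v \<noteq> w"
  obtains N where "N \<in> cylinders \<kappa>" "v \<in> N" "w \<notin> N"
proof -
  obtain i where i: "v i \<noteq> w i" using assms(3) by blast
  then have "i \<in> Field \<kappa>" using assms by (metis domIff mem_sequences_UNIV)
  then obtain b where b: "b \<in> Field \<kappa>" "i \<in> underS \<kappa> b" using underS_step by blast
  show ?thesis
    by (rule that[of "cylinder \<kappa> (v |` underS \<kappa> b)"])
      (use assms b i mem_cylinder_restrict cylinder_restrict_in_cylinders in auto)
qed

lemma Hausdorff_Cantor: "Hausdorff_space (generalized_Cantor \<kappa>)"
  unfolding Hausdorff_space_def topspace_Cantor
proof (intro allI impI)
  fix v w :: "'k \<rightharpoonup> bool" assume "v \<in> points \<and> w \<in> points \<and> v \<noteq> w"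
  then obtain N where N: "N \<in> cylinders \<kappa>" "v \<in> N" "w \<notin> N" and w: "w \<in> points"
    using Cantor_separate by metis
  have "openin (generalized_Cantor \<kappa>) (points - N)"
    using closedin_cylinder[OF N(1)] by (simp add: closedin_def topspace_Cantor)
  then show "\<exists>U V. openin (generalized_Cantor \<kappa>) U \<and> openin (generalized_Cantor \<kappa>) V \<and>
      v \<in> U \<and> w \<in> V \<and> disjnt U V"
    using N w openin_cylinder[OF N(1)] by (metis DiffI disjnt_def Diff_disjoint)
qed

lemma regular_Cantor: "regular_space (generalized_Cantor \<kappa>)"
  unfolding neighbourhood_base_of_closedin[symmetric] neighbourhood_base_of
proof (intro allI impI)
  fix W w assume *: "openin (generalized_Cantor \<kappa>) W \<and> w \<in> W"
  then obtain N where "N \<in> cylinders \<kappa>" "w \<in> N" "N \<subseteq> W" unfolding openin_Cantor by blast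
  then show "\<exists>U V. openin (generalized_Cantor \<kappa>) U \<and> closedin (generalized_Cantor \<kappa>) V \<and>
      w \<in> U \<and> U \<subseteq> V \<and> V \<subseteq> W"
    using openin_cylinder closedin_cylinder by blast
qed

lemma additive_Cantor: "kappa_additive \<kappa> (generalized_Cantor \<kappa>)"
  unfolding kappa_additive_def topspace_Cantor
proof (intro allI impI)
  fix \<U> assume *: "(\<forall>U\<in>\<U>. openin (generalized_Cantor \<kappa>) U) \<and> |\<U>| <o \<kappa>"
  have "\<exists>N\<in>cylinders \<kappa>. w \<in> N \<and> N \<subseteq> points \<inter> \<Inter>\<U>" if w: "w \<in> points \<inter> \<Inter>\<U>" for w
  proof -
    have "\<forall>U\<in>\<U>. \<exists>N. N \<in> cylinders \<kappa> \<and> w \<in> N \<and> N \<subseteq> U"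
      using * w unfolding openin_Cantor by blast
    then obtain n where n: "\<And>U. U \<in> \<U> \<Longrightarrow> n U \<in> cylinders \<kappa> \<and> w \<in> n U \<and> n U \<subseteq> U" by metis
    have "points \<inter> \<Inter>(n ` \<U>) \<in> cylinders \<kappa>"
      by (rule Inter_cylinders[where w = w])
        (use n w * ordLeq_ordLess_trans[OF card_of_image] in auto)
    moreover have "points \<inter> \<Inter>(n ` \<U>) \<subseteq> points \<inter> \<Inter>\<U>" using n by blast
    moreover have "w \<in> points \<inter> \<Inter>(n ` \<U>)" using n w by blast
    ultimately show ?thesis by blast
  qed
  then show "openin (generalized_Cantor \<kappa>) (points \<inter> \<Inter>\<U>)" unfolding openin_Cantor by blast
qed

text \<open>A point of a cylinder can be changed freely beyond the stem, since the stem has length \<open>< \<kappa>\<close>.\<close>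

lemma cylinder_undetermined:
  assumes N: "N \<in> cylinders \<kappa>" "w \<in> N"
  obtains a where "a \<in> Field \<kappa>" "N = cylinder \<kappa> (w |` underS \<kappa> a)"
    "\<And>i v. i \<in> Field \<kappa> \<Longrightarrow> i \<notin> underS \<kappa> a \<Longrightarrow> w(i \<mapsto> v) \<in> N"
proof -
  obtain a where a: "a \<in> Field \<kappa>" "N = cylinder \<kappa> (w |` underS \<kappa> a)" using cylinders_cases[OF N] .
  have wp: "w \<in> points" using N cylinders_subset_points by blast
  have "w(i \<mapsto> v) \<in> N" if "i \<in> Field \<kappa>" "i \<notin> underS \<kappa> a" for i v
    using that wp unfolding a(2) mem_cylinder_restrict[OF wp] by (auto simp: mem_sequences_UNIV)
  then show ?thesis using that a by blast
qed

lemma perfect_Cantor: "perfect_space (generalized_Cantor \<kappa>)"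
  unfolding perfect_space_def
proof (intro ballI notI)
  fix w assume "openin (generalized_Cantor \<kappa>) {w}"
  then have "{w} \<in> cylinders \<kappa>" unfolding openin_Cantor
    using cylinder_nonempty by (metis insertI1 subset_singletonD)
  then obtain a where a: "a \<in> Field \<kappa>" "\<And>i v. i \<in> Field \<kappa> \<Longrightarrow> i \<notin> underS \<kappa> a \<Longrightarrow> w(i \<mapsto> v) \<in> {w}"
    by (rule cylinder_undetermined[OF _ singletonI]) simp
  have "w(a \<mapsto> v) = w" for v using a(2)[OF a(1) underS_irrefl, of v] by simp
  then have "(w(a \<mapsto> True)) a = (w(a \<mapsto> False)) a" by metis
  then show False by simp
qed

section \<open>Weak compactness and the game on the generalized Cantor space\<close>

lemma openin_moves_Inter:
  assumes "kappa_additive \<kappa> X" "\<alpha> \<in> Field \<kappa>"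
    "\<And>\<beta>. \<beta> \<in> underS \<kappa> \<alpha> \<Longrightarrow> openin X (V \<beta>)"
  shows "openin X (moves_Inter X V (underS \<kappa> \<alpha>))"
  unfolding moves_Inter_def
  by (rule openin_kappa_Inter[OF assms(1) underS_less[OF assms(2)] assms(3)])

lemma Card_sequences_underS:
  assumes "strongly_inaccessible \<kappa>" "a \<in> Field \<kappa>"
  shows "|sequences (underS \<kappa> a) (UNIV :: bool set)| <o \<kappa>"
proof -
  let ?S = "sequences (underS \<kappa> a) (UNIV :: bool set)"
  have "inj_on (\<lambda>s. {i. s i = Some True}) ?S"
  proof (rule inj_onI)
    fix s t :: "'k \<rightharpoonup> bool" assume st: "s \<in> ?S" "t \<in> ?S"
      and eq: "{i. s i = Some True} = {i. t i = Some True}"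
    show "s = t"
    proof
      fix i
      have "s i = None \<longleftrightarrow> t i = None" using st by (metis domIff mem_sequences_UNIV)
      moreover have "s i = Some True \<longleftrightarrow> t i = Some True" using eq by blast
      ultimately show "s i = t i" by (cases "s i"; cases "t i") auto
    qed
  qed
  moreover have "(\<lambda>s. {i. s i = Some True}) ` ?S \<subseteq> Pow (underS \<kappa> a)"
  proof (rule image_subsetI)
    fix s assume "s \<in> ?S"
    then have "dom s = underS \<kappa> a" by (simp add: mem_sequences_UNIV)
    then show "{i. s i = Some True} \<in> Pow (underS \<kappa> a)" using domI[of s _ True] by blast
  qed
  ultimately have "|?S| \<le>o |Pow (underS \<kappa> a)|" using card_of_ordLeq by metis
  also have "|Pow (underS \<kappa> a)| =o ctwo ^c |underS \<kappa> a|"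
    unfolding ctwo_def cexp_def Field_card_of by (rule card_of_Pow_Func)
  also have "ctwo ^c |underS \<kappa> a| <o \<kappa>"
    using assms underS_less card_of_Card_order unfolding strongly_inaccessible_def by blast
  finally show ?thesis .
qed

text \<open>Consider the stems whose cylinders are contained in no member of the cover. They form a tree,
  and its levels are small because \<open>\<kappa>\<close> is inaccessible. A branch would be a
  point none of whose basic neighbourhoods is contained in a member of the cover, although the
  point itself lies in a member, which is open. By weak compactness some level \<open>\<alpha>\<close> is therefore empty, so the fewer than \<open>\<kappa>\<close> cylinders with stem of
  length \<open>\<alpha>\<close> refine the cover.\<close>

lemma Lindelof_Cantor:
  assumes "weakly_compact \<kappa>"
  shows "kappa_Lindelof \<kappa> (generalized_Cantor \<kappa>)"
  unfolding kappa_Lindelof_def topspace_Cantor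
proof (intro allI impI)
  fix \<U> assume *: "(\<forall>U\<in>\<U>. openin (generalized_Cantor \<kappa>) U) \<and> points \<subseteq> \<Union>\<U>"
  have si: "strongly_inaccessible \<kappa>" using assms by (simp add: weakly_compact_def)
  obtain z0 where z0: "z0 \<in> Field \<kappa>" using infinite_Field by fastforce
  obtain z1 where z1: "z1 \<in> Field \<kappa>" "z0 \<in> underS \<kappa> z1" using underS_step[OF z0] by blast
  \<comment> \<open>trees consist of sequences of ordinals, so bits are coded by two distinct elements of \<open>\<kappa>\<close>\<close>
  define e where "e b = (if b then z1 else z0)" for b
  have e_inj: "e b = e c \<longleftrightarrow> b = c" for b c using z1 underS_irrefl by (auto simp: e_def)
  have e_Field: "e b \<in> Field \<kappa>" for b using z0 z1 by (simp add: e_def)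
  define code :: "('k \<rightharpoonup> bool) \<Rightarrow> ('k \<rightharpoonup> 'k)" where "code s = map_option e \<circ> s" for s
  have dom_code: "dom (code s) = dom s" for s by (auto simp: code_def dom_def)
  have ran_code: "ran (code s) \<subseteq> Field \<kappa>" for s
    using e_Field by (auto simp: code_def ran_def)
  have code_restrict: "code s |` D = code (s |` D)" for s D
    by (auto simp: code_def restrict_map_def)
  have code_inj: "s = t" if "code s = code t" for s t
  proof
    fix i show "s i = t i" using fun_cong[OF that, of i] e_inj
      by (cases "s i"; cases "t i") (auto simp: code_def)
  qed
  define bad where "bad = {s \<in> short_sequences \<kappa> UNIV. \<not> (\<exists>U\<in>\<U>. cylinder \<kappa> s \<subseteq> U)}"
  define T where "T = code ` bad"
  have "tree \<kappa> T"
    unfolding tree_def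
  proof (intro conjI ballI impI)
    show "T \<subseteq> short_sequences \<kappa> (Field \<kappa>)"
      using dom_code ran_code by (auto simp: T_def bad_def short_sequences_def sequences_def)
    fix t \<alpha> assume t: "t \<in> T" and \<alpha>: "\<alpha> \<in> Field \<kappa>" "underS \<kappa> \<alpha> \<subseteq> dom t"
    obtain s where s: "s \<in> bad" "t = code s" using t by (auto simp: T_def)
    have "dom (s |` underS \<kappa> \<alpha>) = underS \<kappa> \<alpha>" using \<alpha>(2) s(2) dom_code by auto
    then have "s |` underS \<kappa> \<alpha> \<in> short_sequences \<kappa> UNIV"
      using \<alpha>(1) unfolding short_sequences_def by (auto simp: mem_sequences_UNIV)
    moreover have "cylinder \<kappa> s \<subseteq> cylinder \<kappa> (s |` underS \<kappa> \<alpha>)"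
      by (rule cylinder_antimono) (auto simp: map_le_def)
    ultimately have "s |` underS \<kappa> \<alpha> \<in> bad" using s(1) by (auto simp: bad_def)
    then show "t |` underS \<kappa> \<alpha> \<in> T" using s(2) code_restrict by (simp add: T_def)
  qed
  moreover have "|tree_level \<kappa> T \<alpha>| <o \<kappa>" if \<alpha>: "\<alpha> \<in> Field \<kappa>" for \<alpha>
  proof -
    have "tree_level \<kappa> T \<alpha> \<subseteq> code ` sequences (underS \<kappa> \<alpha>) UNIV"
      using dom_code by (auto simp: tree_level_def T_def sequences_def)
    then have "|tree_level \<kappa> T \<alpha>| \<le>o |sequences (underS \<kappa> \<alpha>) (UNIV :: bool set)|"
      by (rule surj_imp_ordLeq)
    then show ?thesis using Card_sequences_underS[OF si \<alpha>] by (rule ordLeq_ordLess_trans)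
  qed
  moreover have "\<not> (\<exists>b \<in> sequences (Field \<kappa>) (Field \<kappa>). \<forall>\<alpha>\<in>Field \<kappa>. b |` underS \<kappa> \<alpha> \<in> T)"
  proof
    assume "\<exists>b \<in> sequences (Field \<kappa>) (Field \<kappa>). \<forall>\<alpha>\<in>Field \<kappa>. b |` underS \<kappa> \<alpha> \<in> T"
    then obtain b where b: "dom b = Field \<kappa>" "\<And>\<alpha>. \<alpha> \<in> Field \<kappa> \<Longrightarrow> b |` underS \<kappa> \<alpha> \<in> T"
      by (auto simp: sequences_def)
    define w where "w i = map_option (\<lambda>k. k = z1) (b i)" for i
    have w: "w \<in> points" using b(1) by (auto simp: mem_sequences_UNIV w_def dom_def)
    have bad: "w |` underS \<kappa> \<alpha> \<in> bad" if \<alpha>: "\<alpha> \<in> Field \<kappa>" for \<alpha>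
    proof -
      obtain s where s: "s \<in> bad" "b |` underS \<kappa> \<alpha> = code s" using b(2)[OF \<alpha>] by (auto simp: T_def)
      have "w |` underS \<kappa> \<alpha> = s"
      proof
        fix i
        have "(b |` underS \<kappa> \<alpha>) i = map_option e (s i)" using s(2) by (simp add: code_def)
        moreover have "(w |` underS \<kappa> \<alpha>) i = map_option (\<lambda>k. k = z1) ((b |` underS \<kappa> \<alpha>) i)"
          by (simp add: w_def restrict_map_def)
        moreover have "(e v = z1) = v" for v using e_inj[of v True] by (simp add: e_def)
        ultimately show "(w |` underS \<kappa> \<alpha>) i = s i" by (cases "s i") auto
      qed
      then show ?thesis using s by simp
    qed
    obtain U where U: "U \<in> \<U>" "w \<in> U" using * w by blast
    then obtain N where N: "N \<in> cylinders \<kappa>" "w \<in> N" "N \<subseteq> U"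
      using * unfolding openin_Cantor by blast
    obtain a where "a \<in> Field \<kappa>" "N = cylinder \<kappa> (w |` underS \<kappa> a)"
      using cylinders_cases[OF N(1,2)] by blast
    then show False using bad[of a] N(3) U(1) by (auto simp: bad_def)
  qed
  ultimately obtain \<alpha> where \<alpha>: "\<alpha> \<in> Field \<kappa>" "tree_level \<kappa> T \<alpha> = {}"
    using assms unfolding weakly_compact_def by metis
  have "\<exists>U\<in>\<U>. cylinder \<kappa> s \<subseteq> U" if s: "s \<in> sequences (underS \<kappa> \<alpha>) UNIV" for s
  proof (rule ccontr)
    assume "\<not> ?thesis"
    then have "s \<in> bad" using s \<alpha>(1) by (auto simp: bad_def short_sequences_def)
    then have "code s \<in> tree_level \<kappa> T \<alpha>"
      using s dom_code ran_code by (auto simp: tree_level_def T_def sequences_def)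
    then show False using \<alpha>(2) by blast
  qed
  then obtain u where u: "\<And>s. s \<in> sequences (underS \<kappa> \<alpha>) UNIV \<Longrightarrow> u s \<in> \<U> \<and> cylinder \<kappa> s \<subseteq> u s"
    by metis
  show "\<exists>\<V>\<subseteq>\<U>. |\<V>| <o \<kappa> \<and> points \<subseteq> \<Union>\<V>"
  proof (intro exI conjI)
    show "u ` sequences (underS \<kappa> \<alpha>) UNIV \<subseteq> \<U>" using u by blast
    show "|u ` sequences (underS \<kappa> \<alpha>) UNIV| <o \<kappa>"
      by (rule ordLeq_ordLess_trans[OF card_of_image Card_sequences_underS[OF si \<alpha>(1)]])
    show "points \<subseteq> \<Union>(u ` sequences (underS \<kappa> \<alpha>) UNIV)"
    proof
      fix w assume w: "w \<in> points"
      have "w |` underS \<kappa> \<alpha> \<in> sequences (underS \<kappa> \<alpha>) UNIV"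
        using w underS_Field[of \<alpha>] by (auto simp: mem_sequences_UNIV)
      moreover have "w \<in> cylinder \<kappa> (w |` underS \<kappa> \<alpha>)" using mem_cylinder_restrict[OF w] w by blast
      ultimately show "w \<in> \<Union>(u ` sequences (underS \<kappa> \<alpha>) UNIV)" using u by blast
    qed
  qed
qed

lemma weight_Cantor:
  assumes "|short_sequences \<kappa> (UNIV :: bool set)| =o \<kappa>"
  shows "weight_at_most \<kappa> (generalized_Cantor \<kappa>)"
proof -
  have "|cylinders \<kappa>| \<le>o \<kappa>"
    unfolding cylinders_def by (rule ordLeq_ordIso_trans[OF card_of_image assms])
  then show ?thesis
    unfolding weight_at_most_def using openin_cylinder by (auto simp: openin_Cantor)
qed

text \<open>II answers \<open>(U, x)\<close> with a cylinder around \<open>x\<close> inside \<open>U\<close>. The answers of a play are decreasing,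
  so they intersect pairwise and hence have a common point at every stage.\<close>

lemma strategy_Cantor: "\<exists>\<sigma>. winning_strategy_II \<kappa> (generalized_Cantor \<kappa>) \<sigma>"
proof
  let ?X = "generalized_Cantor \<kappa>"
  define pick where "pick U w = (SOME N. N \<in> cylinders \<kappa> \<and> w \<in> N \<and> N \<subseteq> U)"
    for U :: "('k \<rightharpoonup> bool) set" and w
  have pick: "pick U w \<in> cylinders \<kappa> \<and> w \<in> pick U w \<and> pick U w \<subseteq> U" if "openin ?X U" "w \<in> U" for U w
    unfolding pick_def by (rule someI_ex) (use that in \<open>auto simp: openin_Cantor\<close>)
  define \<sigma> :: "('k, 'k \<rightharpoonup> bool) strategy_II" where "\<sigma> \<alpha> U w V = pick (U \<alpha>) (w \<alpha>)" for \<alpha> U w V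
  show "winning_strategy_II \<kappa> ?X \<sigma>"
    unfolding winning_strategy_II_def
  proof (intro allI impI)
    fix U w V D
    assume *: "ofilter \<kappa> D \<and> (\<forall>\<alpha>\<in>D. legal_I \<kappa> ?X U w V \<alpha> \<and> follows \<kappa> \<sigma> U w V \<alpha>)"
    have DF: "D \<subseteq> Field \<kappa>" using * by (simp add: ofilter_def)
    have V: "V \<alpha> = pick (U \<alpha>) (w \<alpha>)" if "\<alpha> \<in> D" for \<alpha>
      using * that DF under_eq[of \<alpha>] by (auto simp: follows_def \<sigma>_def)
    have main: "V \<alpha> \<in> cylinders \<kappa> \<and> w \<alpha> \<in> V \<alpha> \<and> V \<alpha> \<subseteq> U \<alpha> \<and>
        U \<alpha> \<subseteq> moves_Inter ?X V (underS \<kappa> \<alpha>)" if "\<alpha> \<in> D" for \<alpha>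
    proof -
      have "\<alpha> \<in> Field \<kappa>" using that DF by blast
      then have "\<alpha> \<in> D \<longrightarrow> ?thesis"
      proof (induction rule: ordinal_induct)
        case (less \<alpha>)
        show ?case
        proof
          assume \<alpha>: "\<alpha> \<in> D"
          have "openin ?X (V \<beta>)" if "\<beta> \<in> underS \<kappa> \<alpha>" for \<beta>
            using less.IH[OF that] ofilter_closed[of D \<alpha> \<beta>] * \<alpha> that openin_cylinder by blast
          then have op: "openin ?X (moves_Inter ?X V (underS \<kappa> \<alpha>))"
            by (intro openin_moves_Inter additive_Cantor less.hyps)
          have "openin (subtopology ?X (moves_Inter ?X V (underS \<kappa> \<alpha>))) (U \<alpha>)" "w \<alpha> \<in> U \<alpha>"
            using * \<alpha> by (auto simp: legal_I_def)
          then have "openin ?X (U \<alpha>)" "U \<alpha> \<subseteq> moves_Inter ?X V (underS \<kappa> \<alpha>)"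
            using op openin_open_subtopology by blast+
          then show "V \<alpha> \<in> cylinders \<kappa> \<and> w \<alpha> \<in> V \<alpha> \<and> V \<alpha> \<subseteq> U \<alpha> \<and>
              U \<alpha> \<subseteq> moves_Inter ?X V (underS \<kappa> \<alpha>)"
            using pick[of "U \<alpha>" "w \<alpha>"] V[OF \<alpha>] \<open>w \<alpha> \<in> U \<alpha>\<close> by simp
        qed
      qed
      then show ?thesis using that by blast
    qed
    have "legal_II \<kappa> ?X U w V \<alpha>" if \<alpha>: "\<alpha> \<in> D" for \<alpha>
    proof -
      have "V \<alpha> = V \<alpha> \<inter> moves_Inter ?X V (underS \<kappa> \<alpha>)" using main[OF \<alpha>] by blast
      then show ?thesis
        unfolding legal_II_def openin_subtopology using main[OF \<alpha>] openin_cylinder by blast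
    qed
    moreover have "moves_Inter ?X V D \<noteq> {}"
    proof -
      have nested: "V \<alpha> \<subseteq> V \<beta>" if "\<alpha> \<in> D" "\<beta> \<in> underS \<kappa> \<alpha>" for \<alpha> \<beta>
        using main[OF that(1)] that(2) unfolding moves_Inter_def by blast
      have "V \<alpha> \<inter> V \<beta> \<noteq> {}" if "\<alpha> \<in> D" "\<beta> \<in> D" for \<alpha> \<beta>
      proof -
        have "\<alpha> \<in> Field \<kappa>" "\<beta> \<in> Field \<kappa>" using that DF by auto
        then show ?thesis
          by (rule underS_cases) (use nested main that in blast)+
      qed
      then obtain x where "x \<in> points" "\<And>N. N \<in> V ` D \<Longrightarrow> x \<in> N"
        using Inter_cylinders_nonempty[of "V ` D"] main by blast
      then have "x \<in> moves_Inter ?X V D" by (auto simp: moves_Inter_def topspace_Cantor)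
      then show ?thesis by blast
    qed
    ultimately show "(\<forall>\<alpha>\<in>D. legal_II \<kappa> ?X U w V \<alpha>) \<and>
        (limit_ordinal \<kappa> D \<longrightarrow> moves_Inter ?X V D \<noteq> {})" by blast
  qed
qed

text \<open>Let \<open>c\<close> be the length of the stem of \<open>N\<close> and number the elements of \<open>P\<close> other than \<open>p\<close> by an
  interval \<open>[c, b)\<close>. Now \<open>N\<close> is split like a comb: the tooth number \<open>i\<close> consists of the points whose
  first value \<open>False\<close> at or after \<open>c\<close> occurs at \<open>i\<close>, and \<open>p\<close> receives the remaining points, those
  that are constantly \<open>True\<close> on \<open>[c, b)\<close>. Such points exist whatever the order type of \<open>[c, b)\<close>,
  which is why one element of \<open>P\<close> is left out of the numbering.

  If all points of \<open>N\<close> agree below \<open>a\<close>, then \<open>a \<le> c\<close>; as \<open>P\<close> has at least two elements, every new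
  stem also contains \<open>c\<close>, so all points of a piece agree at \<open>a\<close> too.\<close>

lemma cylinder_split:
  assumes N: "N \<in> cylinders \<kappa>" and P: "|P| <o \<kappa>" "p \<in> P" "q \<in> P" "p \<noteq> q"
    and a: "a \<in> Field \<kappa>" "\<And>i v w. i \<in> underS \<kappa> a \<Longrightarrow> v \<in> N \<Longrightarrow> w \<in> N \<Longrightarrow> v i = w i"
  obtains M where "\<And>p. p \<in> P \<Longrightarrow> M p \<in> cylinders \<kappa>" "(\<Union>p\<in>P. M p) = N"
    "\<And>p q. p \<in> P \<Longrightarrow> q \<in> P \<Longrightarrow> M p \<inter> M q \<noteq> {} \<Longrightarrow> p = q"
    "\<And>p v w. p \<in> P \<Longrightarrow> v \<in> M p \<Longrightarrow> w \<in> M p \<Longrightarrow> v a = w a"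
proof -
  obtain z where z: "z \<in> N" using cylinder_nonempty[OF N] by blast
  have zp: "z \<in> points" using z N cylinders_subset_points by blast
  obtain c where c: "c \<in> Field \<kappa>" "N = cylinder \<kappa> (z |` underS \<kappa> c)"
    "\<And>i v. i \<in> Field \<kappa> \<Longrightarrow> i \<notin> underS \<kappa> c \<Longrightarrow> z(i \<mapsto> v) \<in> N"
    using cylinder_undetermined[OF N z] by blast
  have ac: "a = c \<or> a \<in> underS \<kappa> c"
  proof (rule ccontr)
    assume "\<not> ?thesis"
    then have "c \<in> underS \<kappa> a" using underS_cases[OF a(1) c(1)] by blast
    from a(2)[OF this c(3)[OF c(1) underS_irrefl, of True] c(3)[OF c(1) underS_irrefl, of False]]
    show False by simp
  qed
  let ?Q = "P - {p}"
  have "|?Q| <o \<kappa>" by (rule ordLeq_ordLess_trans[OF card_of_mono1 P(1)]) auto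
  then obtain b f where b: "b \<in> Field \<kappa>" "c = b \<or> c \<in> underS \<kappa> b"
    and f: "bij_betw f ?Q (underS \<kappa> b - underS \<kappa> c)"
    using small_set_as_interval[OF c(1)] by blast
  have "f q \<in> underS \<kappa> b - underS \<kappa> c" using f P bij_betwE by fastforce
  then have cb: "c \<in> underS \<kappa> b" using b(2) by auto
  \<comment> \<open>the position of the first \<open>False\<close>; the value \<open>b\<close> lies beyond the stem of the piece for \<open>p\<close>\<close>
  define g where "g r = (if r = p then b else f r)" for r
  have gQ: "g r \<in> underS \<kappa> b" "g r \<notin> underS \<kappa> c" if "r \<in> P" "r \<noteq> p" for r
    using f that bij_betwE by (fastforce simp: g_def)+
  define path where "path r = (\<lambda>i. if i \<in> underS \<kappa> c then z i
      else if i \<in> Field \<kappa> then Some (i \<noteq> g r) else None)" for r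
  define len where "len r = (if r = p then underS \<kappa> b else under \<kappa> (f r))" for r
  define M where "M r = cylinder \<kappa> (path r |` len r)" for r
  have zdom: "z i = None \<longleftrightarrow> i \<notin> Field \<kappa>" for i using zp by (metis domIff mem_sequences_UNIV)
  show ?thesis
  proof
    have F: "f r \<in> Field \<kappa>" "f r \<in> underS \<kappa> b" "f r \<notin> underS \<kappa> c" if "r \<in> P" "r \<noteq> p" for r
      using gQ[OF that] that underS_Field[of b] by (auto simp: g_def)
    have path_points: "path r \<in> points" for r
      using zdom underS_Field[of c] by (auto simp: mem_sequences_UNIV path_def dom_def)
    have mem: "y \<in> M r \<longleftrightarrow> y \<in> points \<and> (\<forall>i\<in>len r. y i = path r i)" for y r
      unfolding M_def by (rule mem_cylinder_restrict[OF path_points])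
    have memN: "y \<in> N \<longleftrightarrow> y \<in> points \<and> (\<forall>i\<in>underS \<kappa> c. y i = z i)" for y
      unfolding c(2) by (rule mem_cylinder_restrict[OF zp])
    have len_ofilter: "ofilter \<kappa> (len r)" for r
      by (simp add: len_def ofilter_under ofilter_underS)
    have c_len: "c \<in> len r" if r: "r \<in> P" for r
    proof (cases "r = p")
      case True
      then show ?thesis using cb by (simp add: len_def)
    next
      case False
      then show ?thesis
        using underS_cases[OF F(1)[OF r False] c(1)] F[OF r False] under_eq[of "f r"]
        by (auto simp: len_def)
    qed
    have g_len: "underS \<kappa> (g r) \<subseteq> len r" if r: "r \<in> P" for r
      using under_eq[OF F(1)[OF r]] by (auto simp: len_def g_def)
    show "M r \<in> cylinders \<kappa>" if r: "r \<in> P" for r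
    proof -
      obtain d where "d \<in> Field \<kappa>" "len r = underS \<kappa> d"
        using b(1) under_eq_underS[OF F(1)[OF r]] by (metis len_def)
      then show ?thesis using cylinder_restrict_in_cylinders[OF path_points] by (simp add: M_def)
    qed
    show "v a = w a" if "r \<in> P" "v \<in> M r" "w \<in> M r" for r v w
    proof -
      have "a \<in> len r" using ac c_len[OF that(1)] ofilter_closed[OF len_ofilter] by blast
      then show ?thesis using that(2,3) mem by metis
    qed
    show "r = s" if rs: "r \<in> P" "s \<in> P" "M r \<inter> M s \<noteq> {}" for r s
    proof (rule ccontr)
      assume "r \<noteq> s"
      have conflict: False
        if r: "r \<in> P" and s: "s \<in> P" and lt: "g r \<in> underS \<kappa> (g s)" and y: "y \<in> M r" "y \<in> M s" for r s y
      proof -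
        have "r \<noteq> p"
        proof
          assume "r = p"
          then have "b \<in> underS \<kappa> (g s)" using lt by (simp add: g_def)
          then show False
            using gQ(1)[OF s] underS_irrefl underS_trans by (metis g_def)
        qed
        then have gr: "g r = f r" "f r \<in> Field \<kappa>" "f r \<notin> underS \<kappa> c" using F[OF r] by (auto simp: g_def)
        have "f r \<in> len s" using g_len[OF s] lt gr by auto
        then have "y (f r) = path s (f r)" using y mem by blast
        moreover have "f r \<in> len r" using \<open>r \<noteq> p\<close> under_eq[OF gr(2)] by (simp add: len_def)
        then have "y (f r) = path r (f r)" using y mem by blast
        ultimately show False using gr lt underS_irrefl by (auto simp: path_def)
      qed
      obtain y where y: "y \<in> M r" "y \<in> M s" using rs(3) by blast
      have "g r \<noteq> g s"
      proof
        assume eq: "g r = g s"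
        then have "r \<noteq> p" "s \<noteq> p"
          using \<open>r \<noteq> s\<close> gQ(1)[OF rs(1)] gQ(1)[OF rs(2)] underS_irrefl by (metis g_def)+
        then show False using eq \<open>r \<noteq> s\<close> rs f by (auto simp: g_def bij_betw_def inj_on_def)
      qed
      moreover have "g r \<in> Field \<kappa>" "g s \<in> Field \<kappa>" using rs F b(1) by (auto simp: g_def)
      ultimately show False
        using underS_cases[of "g r" "g s"] conflict[OF rs(1,2)] conflict[OF rs(2,1)] y by blast
    qed
    show "(\<Union>r\<in>P. M r) = N"
    proof (intro equalityI subsetI)
      fix y assume "y \<in> (\<Union>r\<in>P. M r)"
      then obtain r where r: "r \<in> P" "y \<in> M r" by blast
      have "y i = z i" if "i \<in> underS \<kappa> c" for i
      proof -
        have "i \<in> len r" using ofilter_closed[OF len_ofilter c_len[OF r(1)] that] .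
        then have "y i = path r i" using r(2) mem by blast
        then show ?thesis using that by (simp add: path_def)
      qed
      then show "y \<in> N" using memN r(2) mem by blast
    next
      fix y assume y: "y \<in> N"
      have yp: "y \<in> points" and yz: "\<And>i. i \<in> underS \<kappa> c \<Longrightarrow> y i = z i" using y memN by auto
      have y_dom: "y i \<noteq> None" if "i \<in> Field \<kappa>" for i
        using that yp by (metis domIff mem_sequences_UNIV)
      define S where "S = {i \<in> underS \<kappa> b - underS \<kappa> c. y i = Some False}"
      have True_if: "y i = Some True" if "i \<in> underS \<kappa> b" "i \<notin> underS \<kappa> c" "i \<notin> S" for i
        using y_dom[of i] that underS_Field[of b] by (cases "y i") (auto simp: S_def)
      show "y \<in> (\<Union>r\<in>P. M r)"
      proof (cases "S = {}")
        case True
        have "y i = path p i" if i: "i \<in> underS \<kappa> b" for i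
          using yz True_if[OF i] True i underS_Field[of b] underS_irrefl[of b]
          by (auto simp: path_def g_def)
        then have "y \<in> M p" using mem yp by (simp add: len_def)
        then show ?thesis using P by blast
      next
        case False
        then obtain i where i: "i \<in> S" by blast
        have S_Field: "S \<subseteq> Field \<kappa>" using underS_Field[of b] by (auto simp: S_def)
        obtain j where j: "j \<in> S" "\<And>k. k \<in> underS \<kappa> j \<Longrightarrow> k \<notin> S"
          by (rule least_ordinal[OF i S_Field]) blast
        have jb: "j \<in> underS \<kappa> b" "y j = Some False" "j \<notin> underS \<kappa> c" using j(1) by (auto simp: S_def)
        then obtain r where r: "r \<in> P" "r \<noteq> p" "j = f r"
          using f by (auto simp: bij_betw_def)
        have "y i = path r i" if i: "i \<in> under \<kappa> j" for i
        proof (cases "i = j")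
          case True
          then show ?thesis using jb r underS_Field[of b] by (auto simp: path_def g_def)
        next
          case False
          then have ij: "i \<in> underS \<kappa> j" using i by (simp add: under_def underS_def)
          then have ib: "i \<in> underS \<kappa> b" using jb(1) by (rule underS_trans)
          show ?thesis
            using yz True_if[OF ib] j(2)[OF ij] False ib underS_Field[of b] r
            by (auto simp: path_def g_def)
        qed
        then have "y \<in> M r" using mem yp r by (simp add: len_def)
        then show ?thesis using r by blast
      qed
    qed
  qed
qed

section \<open>Clopen bases and small clopen partitions\<close>

text \<open>By regularity there are open sets \<open>U \<supseteq> f 0 \<supseteq> C 0 \<supseteq> f 1 \<supseteq> C 1 \<supseteq> \<dots>\<close> around \<open>x\<close> with \<open>C n\<close>
  closed. The intersection of the \<open>f n\<close> is that of the \<open>C n\<close>, so it is closed, and it is open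
  because \<open>\<kappa>\<close> is uncountable.\<close>

lemma clopen_neighbourhood:
  assumes "regular_space X" "kappa_additive \<kappa> X" "openin X U" "x \<in> U"
  obtains K where "openin X K" "closedin X K" "x \<in> K" "K \<subseteq> U"
proof -
  have "\<exists>f. \<forall>n. (openin X (f n) \<and> x \<in> f n \<and> f n \<subseteq> U) \<and> (\<exists>C. closedin X C \<and> f (Suc n) \<subseteq> C \<and> C \<subseteq> f n)"
  proof (rule dependent_nat_choice)
    show "\<exists>V. openin X V \<and> x \<in> V \<and> V \<subseteq> U" using assms(3,4) by blast
    fix V n assume V: "openin X V \<and> x \<in> V \<and> V \<subseteq> U"
    have "\<exists>W C. openin X W \<and> closedin X C \<and> x \<in> W \<and> W \<subseteq> C \<and> C \<subseteq> V"
      using assms(1) V unfolding neighbourhood_base_of_closedin[symmetric] neighbourhood_base_of by blast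
    then show "\<exists>W. (openin X W \<and> x \<in> W \<and> W \<subseteq> U) \<and> (\<exists>C. closedin X C \<and> W \<subseteq> C \<and> C \<subseteq> V)"
      using V by (meson subset_trans)
  qed
  then obtain f where *: "\<forall>n. (openin X (f n) \<and> x \<in> f n \<and> f n \<subseteq> U) \<and>
      (\<exists>C. closedin X C \<and> f (Suc n) \<subseteq> C \<and> C \<subseteq> f n)" ..
  then have f: "openin X (f n)" "x \<in> f n" "f n \<subseteq> U" for n by simp_all
  have "\<forall>n. \<exists>C. closedin X C \<and> f (Suc n) \<subseteq> C \<and> C \<subseteq> f n" using * by simp
  then obtain C where "\<forall>n. closedin X (C n) \<and> f (Suc n) \<subseteq> C n \<and> C n \<subseteq> f n"
    by (rule choice[THEN exE])
  then have C: "closedin X (C n)" "f (Suc n) \<subseteq> C n" "C n \<subseteq> f n" for n by simp_all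
  let ?K = "topspace X \<inter> (\<Inter>n. f n)"
  have "|UNIV :: nat set| <o \<kappa>" by (rule ordIso_ordLess_trans[OF card_of_nat uncountable])
  then have "openin X ?K" by (rule openin_kappa_Inter[OF assms(2) _ f(1)])
  moreover have "?K = (\<Inter>n. C n)"
  proof (intro equalityI subsetI)
    fix y assume "y \<in> ?K"
    then show "y \<in> (\<Inter>n. C n)" using C(2) by blast
  next
    fix y assume y: "y \<in> (\<Inter>n. C n)"
    then have "y \<in> topspace X" using C(1) closedin_subset by blast
    then show "y \<in> ?K" using y C(3) by blast
  qed
  then have "closedin X ?K" using closedin_INT[of UNIV X C] C(1) by simp
  moreover have "x \<in> ?K" using f(2) assms(3,4) openin_subset by fastforce
  moreover have "?K \<subseteq> U" using f(3) by blast
  ultimately show ?thesis using that by blast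
qed

text \<open>To keep the size of the base, choose one clopen set between each pair of basic open sets
  \<open>P \<subseteq> Q\<close> that admits one; there are at most \<open>\<kappa>\<close> such pairs.\<close>

lemma clopen_base:
  fixes X :: "'a topology"
  assumes reg: "regular_space X" and add: "kappa_additive \<kappa> X" and w: "weight_at_most \<kappa> X"
  obtains B where "\<And>\<alpha>. openin X (B \<alpha>)" "\<And>\<alpha>. closedin X (B \<alpha>)"
    "\<And>U x. openin X U \<Longrightarrow> x \<in> U \<Longrightarrow> \<exists>\<alpha>\<in>Field \<kappa>. x \<in> B \<alpha> \<and> B \<alpha> \<subseteq> U"
proof -
  obtain \<B> where *: "|\<B>| \<le>o \<kappa> \<and> (\<forall>B\<in>\<B>. openin X B) \<and>
      (\<forall>U x. openin X U \<and> x \<in> U \<longrightarrow> (\<exists>B\<in>\<B>. x \<in> B \<and> B \<subseteq> U))"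
    using w unfolding weight_at_most_def ..
  then have \<B>: "|\<B>| \<le>o \<kappa>" "\<And>B. B \<in> \<B> \<Longrightarrow> openin X B"
    "\<And>U x. openin X U \<Longrightarrow> x \<in> U \<Longrightarrow> \<exists>B\<in>\<B>. x \<in> B \<and> B \<subseteq> U"
    by simp_all
  define good where "good pq K \<longleftrightarrow> openin X K \<and> closedin X K \<and> fst pq \<subseteq> K \<and> K \<subseteq> snd pq"
    for pq :: "'a set \<times> 'a set" and K
  define S where "S = {pq \<in> \<B> \<times> \<B>. \<exists>K. good pq K}"
  define k where "k pq = (SOME K. good pq K)" for pq
  have k: "good pq (k pq)" if "pq \<in> S" for pq
    using that someI_ex[of "good pq"] by (simp add: S_def k_def)
  have "|S| \<le>o |\<B> \<times> \<B>|" by (rule card_of_mono1) (auto simp: S_def)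
  also have "|\<B> \<times> \<B>| \<le>o \<kappa>"
    by (rule card_of_Times_ordLeq_infinite_Field[OF infinite_Field \<B>(1,1) Card_order])
  also have "\<kappa> =o |Field \<kappa>|" by (rule ordIso_symmetric[OF card_of_Field_ordIso[OF Card_order]])
  finally obtain g where g: "inj_on g S" "g ` S \<subseteq> Field \<kappa>" using card_of_ordLeq[of S "Field \<kappa>"] by metis
  \<comment> \<open>indices that code no pair are assigned the empty set\<close>
  define B where "B \<alpha> = (if \<alpha> \<in> g ` S then k (inv_into S g \<alpha>) else {})" for \<alpha>
  have B_good: "openin X (B \<alpha>) \<and> closedin X (B \<alpha>)" for \<alpha>
    using k inv_into_into[of \<alpha> g S] by (auto simp: B_def good_def)
  have "\<exists>\<alpha>\<in>Field \<kappa>. x \<in> B \<alpha> \<and> B \<alpha> \<subseteq> U" if U: "openin X U" "x \<in> U" for U x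
  proof -
    obtain Q where Q: "Q \<in> \<B>" "x \<in> Q" "Q \<subseteq> U" using \<B>(3)[OF U] by blast
    obtain K where K: "openin X K" "closedin X K" "x \<in> K" "K \<subseteq> Q"
      using clopen_neighbourhood[OF reg add \<B>(2)[OF Q(1)] Q(2)] .
    obtain P where P: "P \<in> \<B>" "x \<in> P" "P \<subseteq> K" using \<B>(3)[OF K(1,3)] by blast
    have "good (P, Q) K" using P K by (simp add: good_def)
    then have S: "(P, Q) \<in> S" using P Q by (auto simp: S_def)
    have "B (g (P, Q)) = k (P, Q)" using S g(1) by (simp add: B_def)
    moreover have "P \<subseteq> k (P, Q)" "k (P, Q) \<subseteq> Q" using k[OF S] by (auto simp: good_def)
    ultimately show ?thesis using P Q g(2) S by (intro bexI[of _ "g (P, Q)"]) auto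
  qed
  then show ?thesis using that B_good by blast
qed

text \<open>Take a small cover of \<open>C\<close> by clopen sets that respect the neighbourhoods, and let \<open>P\<close> consist of the
  atoms of the Boolean algebra it generates. Atoms are clopen by additivity. There are fewer than
  \<open>\<kappa>\<close> of them because they are a disjoint open cover of \<open>C\<close>: the small subcover provided by the
  \<open>\<kappa>\<close>-Lindelof property has to contain every atom.\<close>

lemma small_clopen_partition:
  assumes reg: "regular_space X" and add: "kappa_additive \<kappa> X" and Lind: "kappa_Lindelof \<kappa> X"
    and C: "openin X C" "closedin X C"
    and nbh: "\<And>x. x \<in> C \<Longrightarrow> openin X (G x) \<and> x \<in> G x"
  obtains P where "|P| <o \<kappa>" "\<Union>P = C" "{} \<notin> P"
    "\<And>A. A \<in> P \<Longrightarrow> openin X A" "\<And>A. A \<in> P \<Longrightarrow> closedin X A" "\<And>A. A \<in> P \<Longrightarrow> \<exists>x\<in>C. A \<subseteq> G x"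
    "\<And>A B. A \<in> P \<Longrightarrow> B \<in> P \<Longrightarrow> A \<inter> B \<noteq> {} \<Longrightarrow> A = B"
proof -
  have "\<exists>K. openin X K \<and> closedin X K \<and> x \<in> K \<and> K \<subseteq> G x \<inter> C" if x: "x \<in> C" for x
  proof -
    have "openin X (G x \<inter> C)" "x \<in> G x \<inter> C" using nbh[OF x] C x by auto
    then show ?thesis using clopen_neighbourhood[OF reg add] by metis
  qed
  then obtain K where K: "\<And>x. x \<in> C \<Longrightarrow> openin X (K x) \<and> closedin X (K x) \<and> x \<in> K x \<and> K x \<subseteq> G x \<inter> C"
    by metis
  let ?D = "topspace X - C"
  have D: "openin X ?D" "closedin X ?D" using C by auto
  have C_sub: "C \<subseteq> topspace X" using C(1) openin_subset by blast
  have "\<forall>U\<in>insert ?D (K ` C). openin X U" using D K by simp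
  moreover have "topspace X \<subseteq> \<Union>(insert ?D (K ` C))" using K by auto
  ultimately have "(\<forall>U\<in>insert ?D (K ` C). openin X U) \<and> topspace X \<subseteq> \<Union>(insert ?D (K ` C))" ..
  then obtain \<V> where \<V>: "\<V> \<subseteq> insert ?D (K ` C)" "|\<V>| <o \<kappa>" "topspace X \<subseteq> \<Union>\<V>"
    using Lind unfolding kappa_Lindelof_def by metis
  have \<V>_clopen: "openin X V" "closedin X V" if "V \<in> \<V>" for V using that \<V>(1) D K by auto
  define atom where "atom y = {z \<in> topspace X. \<forall>V\<in>\<V>. z \<in> V \<longleftrightarrow> y \<in> V}" for y
  have atom_Inter: "atom y = topspace X \<inter> (\<Inter>V\<in>\<V>. if y \<in> V then V else topspace X - V)" for y
    by (auto simp: atom_def split: if_splits)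
  have atom_open: "openin X (atom y)" for y
    unfolding atom_Inter using \<V>_clopen by (intro openin_kappa_Inter[OF add \<V>(2)]) auto
  have atom_closed: "closedin X (atom y)" for y
  proof -
    have "atom y = \<Inter>(insert (topspace X) ((\<lambda>V. if y \<in> V then V else topspace X - V) ` \<V>))"
      unfolding atom_Inter by auto
    also have "closedin X \<dots>"
      using \<V>_clopen by (intro closedin_Inter) auto
    finally show ?thesis .
  qed
  have atom_eq: "atom y = atom z" if "atom y \<inter> atom z \<noteq> {}" for y z
    using that by (auto simp: atom_def)
  have atom_self: "y \<in> atom y" if "y \<in> C" for y using that C_sub by (auto simp: atom_def)
  have atom_small: "\<exists>x\<in>C. atom y \<subseteq> K x" if y: "y \<in> C" for y
  proof -
    obtain V where V: "V \<in> \<V>" "y \<in> V" using \<V>(3) C_sub y by blast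
    then obtain x where "x \<in> C" "V = K x" using \<V>(1) y by blast
    then show ?thesis using V by (auto simp: atom_def)
  qed
  let ?P = "atom ` C"
  have un: "\<Union>?P = C"
    using atom_self atom_small K by blast
  have "\<forall>U\<in>insert ?D ?P. openin X U" using D atom_open by simp
  moreover have "topspace X \<subseteq> \<Union>(insert ?D ?P)" using un by auto
  ultimately have "(\<forall>U\<in>insert ?D ?P. openin X U) \<and> topspace X \<subseteq> \<Union>(insert ?D ?P)" ..
  then obtain \<W> where \<W>: "\<W> \<subseteq> insert ?D ?P" "|\<W>| <o \<kappa>" "topspace X \<subseteq> \<Union>\<W>"
    using Lind unfolding kappa_Lindelof_def by metis
  have "?P \<subseteq> \<W>"
  proof
    fix A assume "A \<in> ?P"
    then obtain y where y: "y \<in> C" "A = atom y" by blast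
    obtain W where W: "W \<in> \<W>" "y \<in> W" using \<W>(3) C_sub y by blast
    then obtain z where "z \<in> C" "W = atom z" using \<W>(1) y by blast
    moreover have "atom y = W"
      using W y atom_eq[of y z] atom_self[of y] \<open>W = atom z\<close> by blast
    ultimately show "A \<in> \<W>" using W y by simp
  qed
  then have "|?P| <o \<kappa>" by (rule ordLeq_ordLess_trans[OF card_of_mono1 \<W>(2)])
  then show ?thesis
  proof (rule that)
    show "\<Union>?P = C" by (rule un)
    show "{} \<notin> ?P" using atom_self by blast
    show "\<exists>x\<in>C. A \<subseteq> G x" if A: "A \<in> ?P" for A
    proof -
      obtain y where y: "y \<in> C" "A = atom y" using A by auto
      obtain x where x: "x \<in> C" "atom y \<subseteq> K x" using atom_small[OF y(1)] by auto
      show ?thesis using x y K[OF x(1)] by (intro bexI[OF _ x(1)]) auto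
    qed
    show "A = B" if "A \<in> ?P" "B \<in> ?P" "A \<inter> B \<noteq> {}" for A B using that atom_eq by blast
  qed (use atom_open atom_closed in auto)
qed

text \<open>A nonempty open set of a perfect space has two points \<open>p\<close> and \<open>q\<close>; removing one of them from
  each of the prescribed neighbourhoods forces them into different pieces.\<close>

lemma small_clopen_partition_nontrivial:
  assumes reg: "regular_space X" and haus: "Hausdorff_space X" and add: "kappa_additive \<kappa> X"
    and Lind: "kappa_Lindelof \<kappa> X"
    and C: "openin X C" "closedin X C" "C \<noteq> {}" and perf: "perfect_space X"
    and nbh: "\<And>x. x \<in> C \<Longrightarrow> openin X (G x) \<and> x \<in> G x"
  obtains P where "|P| <o \<kappa>" "\<Union>P = C" "{} \<notin> P"
    "\<And>A. A \<in> P \<Longrightarrow> openin X A" "\<And>A. A \<in> P \<Longrightarrow> closedin X A" "\<And>A. A \<in> P \<Longrightarrow> \<exists>x\<in>C. A \<subseteq> G x"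
    "\<And>A B. A \<in> P \<Longrightarrow> B \<in> P \<Longrightarrow> A \<inter> B \<noteq> {} \<Longrightarrow> A = B" "\<exists>A\<in>P. \<exists>B\<in>P. A \<noteq> B"
proof -
  obtain p where p: "p \<in> C" using C(3) by blast
  have C_sub: "C \<subseteq> topspace X" using C(1) openin_subset by blast
  have "C \<noteq> {p}" using perf C(1) p C_sub unfolding perfect_space_def by blast
  then obtain q where q: "q \<in> C" "q \<noteq> p" using p by blast
  let ?G = "\<lambda>x. G x - {if x = p then q else p}"
  have nb: "openin X (?G x) \<and> x \<in> ?G x" if x: "x \<in> C" for x
  proof -
    have "closedin X {if x = p then q else p}"
      using closedin_Hausdorff_singleton[OF haus] p q C_sub by auto
    then show ?thesis using nbh[OF x] q by (auto intro: openin_diff)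
  qed
  show ?thesis
  proof (rule small_clopen_partition[OF reg add Lind C(1,2) nb])
    fix P
    assume P: "|P| <o \<kappa>" "\<Union>P = C" "{} \<notin> P" "\<And>A. A \<in> P \<Longrightarrow> openin X A" "\<And>A. A \<in> P \<Longrightarrow> closedin X A"
      "\<And>A. A \<in> P \<Longrightarrow> \<exists>x\<in>C. A \<subseteq> ?G x"
      "\<And>A B. A \<in> P \<Longrightarrow> B \<in> P \<Longrightarrow> A \<inter> B \<noteq> {} \<Longrightarrow> A = B"
    obtain A B where AB: "A \<in> P" "p \<in> A" "B \<in> P" "q \<in> B" using p q P(2) by auto
    have "A \<noteq> B" using P(6)[OF AB(1)] AB by (auto split: if_splits)
    show ?thesis
    proof (rule that[OF P(1-5)])
      show "\<exists>x\<in>C. A \<subseteq> G x" if "A \<in> P" for A using P(6)[OF that] by auto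
      show "A = B" if "A \<in> P" "B \<in> P" "A \<inter> B \<noteq> {}" for A B using P(7)[OF that] .
      show "\<exists>A\<in>P. \<exists>B\<in>P. A \<noteq> B" using AB \<open>A \<noteq> B\<close> by metis
    qed
  qed
qed

lemma perfect_iff_kappa_perfect:
  assumes add: "kappa_additive \<kappa> X"
  shows "perfect_space X \<longleftrightarrow> kappa_perfect \<kappa> X"
proof
  assume perf: "perfect_space X"
  show "kappa_perfect \<kappa> X"
    unfolding kappa_perfect_def
  proof (intro ballI notI)
    fix x assume x: "x \<in> topspace X"
      and "\<exists>\<U>. (\<forall>U\<in>\<U>. openin X U) \<and> |\<U>| <o \<kappa> \<and> topspace X \<inter> \<Inter>\<U> = {x}"
    then obtain \<U> where "(\<forall>U\<in>\<U>. openin X U) \<and> |\<U>| <o \<kappa>" "topspace X \<inter> \<Inter>\<U> = {x}" by auto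
    then have "openin X {x}" using add unfolding kappa_additive_def by metis
    then show False using perf x unfolding perfect_space_def by simp
  qed
next
  assume kperf: "kappa_perfect \<kappa> X"
  show "perfect_space X"
    unfolding perfect_space_def
  proof (intro ballI notI)
    fix x assume x: "x \<in> topspace X" "openin X {x}"
    have "|{{x}}| <o \<kappa>" by (rule finite_less) simp
    moreover have "topspace X \<inter> \<Inter>{{x}} = {x}" using x(1) by auto
    ultimately have "\<exists>\<U>. (\<forall>U\<in>\<U>. openin X U) \<and> |\<U>| <o \<kappa> \<and> topspace X \<inter> \<Inter>\<U> = {x}"
      using x(2) by (intro exI[of _ "{{x}}"]) simp
    then show False using kperf x(1) unfolding kappa_perfect_def by simp
  qed
qed

end

section \<open>The tree of partitions\<close>

text \<open>The outcome of one stage of the construction: the point that I plays, the answer of II, the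
  cell that is selected inside this answer, and the cylinder matched with the cell. The open set
  offered by I is always the intersection of all earlier cells (\<open>prior_cell\<close> below), so it is not
  recorded.\<close>

datatype ('k, 'a) node =
  Node (pt: 'a) (ans: "'a set") (cell: "'a set") (cyl: "('k \<rightharpoonup> bool) set")

text \<open>The sets \<open>B \<alpha>\<close>, \<open>\<alpha> \<in> Field \<kappa>\<close>, are a clopen base of \<open>X\<close>; stage \<open>\<alpha>\<close> of the construction
  takes care of \<open>B \<alpha>\<close>.\<close>

locale partition_tree = regular_cardinal \<kappa> for \<kappa> :: "'k rel" +
  fixes X :: "'a topology" and \<sigma> :: "('k, 'a) strategy_II" and B :: "'k \<Rightarrow> 'a set"
  assumes reg: "regular_space X" and haus: "Hausdorff_space X" and nonempty: "topspace X \<noteq> {}"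
    and add: "kappa_additive \<kappa> X" and perf: "perfect_space X" and Lind: "kappa_Lindelof \<kappa> X"
    and winning: "winning_strategy_II \<kappa> X \<sigma>"
    and B_open: "\<And>\<alpha>. openin X (B \<alpha>)" and B_closed: "\<And>\<alpha>. closedin X (B \<alpha>)"
    and B_base: "\<And>U x. openin X U \<Longrightarrow> x \<in> U \<Longrightarrow> \<exists>\<alpha>\<in>Field \<kappa>. x \<in> B \<alpha> \<and> B \<alpha> \<subseteq> U"
begin

definition prior_cell :: "('k \<Rightarrow> ('k, 'a) node) \<Rightarrow> 'k \<Rightarrow> 'a set" where
  "prior_cell h \<alpha> = topspace X \<inter> (\<Inter>\<beta>\<in>underS \<kappa> \<alpha>. cell (h \<beta>))"

definition prior_cyl :: "('k \<Rightarrow> ('k, 'a) node) \<Rightarrow> 'k \<Rightarrow> ('k \<rightharpoonup> bool) set" where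
  "prior_cyl h \<alpha> = points \<inter> (\<Inter>\<beta>\<in>underS \<kappa> \<alpha>. cyl (h \<beta>))"

text \<open>The answer of \<open>\<sigma>\<close> in round \<open>\<alpha>\<close> when I plays \<open>x\<close> and offers the intersection of the earlier
  cells.\<close>

definition reply :: "('k \<Rightarrow> ('k, 'a) node) \<Rightarrow> 'k \<Rightarrow> 'a \<Rightarrow> 'a set" where
  "reply h \<alpha> x = \<sigma> \<alpha> (restrict (prior_cell h) (under \<kappa> \<alpha>))
     (restrict ((\<lambda>\<beta>. pt (h \<beta>))(\<alpha> := x)) (under \<kappa> \<alpha>)) (restrict (\<lambda>\<beta>. ans (h \<beta>)) (underS \<kappa> \<alpha>))"

definition node_ok :: "('k \<Rightarrow> ('k, 'a) node) \<Rightarrow> 'k \<Rightarrow> bool" where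
  "node_ok h \<alpha> \<longleftrightarrow>
     pt (h \<alpha>) \<in> prior_cell h \<alpha> \<and> ans (h \<alpha>) = reply h \<alpha> (pt (h \<alpha>)) \<and>
     openin X (cell (h \<alpha>)) \<and> closedin X (cell (h \<alpha>)) \<and> cell (h \<alpha>) \<noteq> {} \<and>
     cell (h \<alpha>) \<subseteq> prior_cell h \<alpha> \<and> cell (h \<alpha>) \<subseteq> ans (h \<alpha>) \<and>
     (cell (h \<alpha>) \<subseteq> B \<alpha> \<or> cell (h \<alpha>) \<inter> B \<alpha> = {}) \<and>
     cyl (h \<alpha>) \<in> cylinders \<kappa> \<and> cyl (h \<alpha>) \<subseteq> prior_cyl h \<alpha> \<and>
     (\<forall>v\<in>cyl (h \<alpha>). \<forall>w\<in>cyl (h \<alpha>). v \<alpha> = w \<alpha>)"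

definition history :: "'k set \<Rightarrow> ('k \<Rightarrow> ('k, 'a) node) \<Rightarrow> bool" where
  "history D h \<longleftrightarrow> ofilter \<kappa> D \<and> (\<forall>\<beta>\<in>D. node_ok h \<beta>)"

lemma prior_cell_cong:
  "(\<And>\<beta>. \<beta> \<in> underS \<kappa> \<alpha> \<Longrightarrow> h \<beta> = h' \<beta>) \<Longrightarrow> prior_cell h \<alpha> = prior_cell h' \<alpha>"
  by (simp add: prior_cell_def)

lemma prior_cyl_cong:
  "(\<And>\<beta>. \<beta> \<in> underS \<kappa> \<alpha> \<Longrightarrow> h \<beta> = h' \<beta>) \<Longrightarrow> prior_cyl h \<alpha> = prior_cyl h' \<alpha>"
  by (simp add: prior_cyl_def)

lemma under_cases: "\<beta> \<in> under \<kappa> \<alpha> \<Longrightarrow> \<beta> = \<alpha> \<or> \<beta> \<in> underS \<kappa> \<alpha>"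
  by (auto simp: under_def underS_def)

lemma reply_cong:
  assumes "\<And>\<beta>. \<beta> \<in> underS \<kappa> \<alpha> \<Longrightarrow> h \<beta> = h' \<beta>"
  shows "reply h \<alpha> x = reply h' \<alpha> x"
proof -
  have "prior_cell h \<beta> = prior_cell h' \<beta>" if "\<beta> \<in> under \<kappa> \<alpha>" for \<beta>
    by (rule prior_cell_cong) (use that assms under_cases underS_trans in blast)
  then have 1: "restrict (prior_cell h) (under \<kappa> \<alpha>) = restrict (prior_cell h') (under \<kappa> \<alpha>)"
    by (simp add: restrict_def fun_eq_iff)
  have 2: "restrict ((\<lambda>\<beta>. pt (h \<beta>))(\<alpha> := x)) (under \<kappa> \<alpha>) = restrict ((\<lambda>\<beta>. pt (h' \<beta>))(\<alpha> := x)) (under \<kappa> \<alpha>)"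
    using assms under_cases by (fastforce simp: restrict_def)
  have 3: "restrict (\<lambda>\<beta>. ans (h \<beta>)) (underS \<kappa> \<alpha>) = restrict (\<lambda>\<beta>. ans (h' \<beta>)) (underS \<kappa> \<alpha>)"
    using assms by (simp add: restrict_def fun_eq_iff)
  show ?thesis unfolding reply_def 1 2 3 ..
qed

lemma node_ok_cong:
  assumes "\<And>\<beta>. \<beta> \<in> underS \<kappa> \<alpha> \<Longrightarrow> h \<beta> = h' \<beta>" "h \<alpha> = h' \<alpha>"
  shows "node_ok h \<alpha> = node_ok h' \<alpha>"
proof -
  have 1: "prior_cell h \<alpha> = prior_cell h' \<alpha>" by (rule prior_cell_cong) (rule assms(1))
  have 2: "prior_cyl h \<alpha> = prior_cyl h' \<alpha>" by (rule prior_cyl_cong) (rule assms(1))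
  have 3: "reply h \<alpha> x = reply h' \<alpha> x" for x by (rule reply_cong) (rule assms(1))
  show ?thesis unfolding node_ok_def 1 2 3 assms(2) ..
qed

lemma cell_subset_ans: "node_ok h \<alpha> \<Longrightarrow> cell (h \<alpha>) \<subseteq> ans (h \<alpha>)"
  unfolding node_ok_def by (elim conjE)

lemma history_sub: "history D h \<Longrightarrow> \<alpha> \<in> D \<Longrightarrow> history (underS \<kappa> \<alpha>) h"
  unfolding history_def using ofilter_underS ofilter_closed by blast

lemma history_Field: "history D h \<Longrightarrow> \<alpha> \<in> D \<Longrightarrow> \<alpha> \<in> Field \<kappa>"
  by (auto simp: history_def ofilter_def)

lemma history_node: "history D h \<Longrightarrow> \<alpha> \<in> D \<Longrightarrow> node_ok h \<alpha>"
  by (simp add: history_def)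

lemma prior_cell_clopen:
  assumes "history (underS \<kappa> \<alpha>) h" "\<alpha> \<in> Field \<kappa>"
  shows "openin X (prior_cell h \<alpha>)" "closedin X (prior_cell h \<alpha>)"
proof -
  show "openin X (prior_cell h \<alpha>)"
    unfolding prior_cell_def
    by (rule openin_kappa_Inter[OF add underS_less[OF assms(2)]])
      (use history_node[OF assms(1)] in \<open>simp add: node_ok_def\<close>)
  have "closedin X (\<Inter>(insert (topspace X) ((\<lambda>\<beta>. cell (h \<beta>)) ` underS \<kappa> \<alpha>)))"
    by (rule closedin_Inter) (use history_node[OF assms(1)] in \<open>auto simp: node_ok_def\<close>)
  then show "closedin X (prior_cell h \<alpha>)" by (simp add: prior_cell_def)
qed

lemma cell_antimono: "node_ok h \<alpha> \<Longrightarrow> \<beta> \<in> underS \<kappa> \<alpha> \<Longrightarrow> cell (h \<alpha>) \<subseteq> cell (h \<beta>)"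
  by (auto simp: node_ok_def prior_cell_def)

lemma cyl_antimono: "node_ok h \<alpha> \<Longrightarrow> \<beta> \<in> underS \<kappa> \<alpha> \<Longrightarrow> cyl (h \<alpha>) \<subseteq> cyl (h \<beta>)"
  by (auto simp: node_ok_def prior_cyl_def)

text \<open>The recorded cylinders decrease, so they intersect pairwise.\<close>

lemma history_point:
  assumes "history D h"
  obtains w where "w \<in> points" "\<And>\<beta>. \<beta> \<in> D \<Longrightarrow> w \<in> cyl (h \<beta>)"
proof -
  let ?N = "(\<lambda>\<beta>. cyl (h \<beta>)) ` D"
  have cyls: "cyl (h \<beta>) \<in> cylinders \<kappa>" if "\<beta> \<in> D" for \<beta>
    using history_node[OF assms that] by (simp add: node_ok_def)
  have "cyl (h \<beta>) \<inter> cyl (h \<gamma>) \<noteq> {}" if "\<beta> \<in> D" "\<gamma> \<in> D" for \<beta> \<gamma>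
  proof -
    have ne: "cyl (h \<beta>) \<noteq> {}" "cyl (h \<gamma>) \<noteq> {}" using that cyls cylinder_nonempty by auto
    have "\<beta> \<in> Field \<kappa>" "\<gamma> \<in> Field \<kappa>" using that history_Field[OF assms] by auto
    then show ?thesis
    proof (cases rule: underS_cases)
      case 1
      then show ?thesis using cyl_antimono[OF history_node[OF assms that(2)]] ne by blast
    next
      case 2
      then show ?thesis using ne by simp
    next
      case 3
      then show ?thesis using cyl_antimono[OF history_node[OF assms that(1)]] ne by blast
    qed
  qed
  then have meet: "\<And>M N. M \<in> ?N \<Longrightarrow> N \<in> ?N \<Longrightarrow> M \<inter> N \<noteq> {}" by auto
  have "?N \<subseteq> cylinders \<kappa>" using cyls by auto
  from Inter_cylinders_nonempty[OF this meet] obtain w where "w \<in> points" "\<And>N. N \<in> ?N \<Longrightarrow> w \<in> N"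
    by metis
  then show ?thesis using that by simp
qed

lemma prior_cyl_cylinder:
  assumes "history (underS \<kappa> \<alpha>) h" "\<alpha> \<in> Field \<kappa>"
  shows "prior_cyl h \<alpha> \<in> cylinders \<kappa>"
proof -
  obtain w where w: "w \<in> points" "\<And>\<beta>. \<beta> \<in> underS \<kappa> \<alpha> \<Longrightarrow> w \<in> cyl (h \<beta>)"
    using history_point[OF assms(1)] by metis
  let ?N = "(\<lambda>\<beta>. cyl (h \<beta>)) ` underS \<kappa> \<alpha>"
  have "points \<inter> \<Inter>?N \<in> cylinders \<kappa>"
  proof (rule Inter_cylinders[where w = w])
    show "|?N| <o \<kappa>" by (rule ordLeq_ordLess_trans[OF card_of_image underS_less[OF assms(2)]])
    show "?N \<subseteq> cylinders \<kappa>" using history_node[OF assms(1)] by (auto simp: node_ok_def)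
  qed (use w in auto)
  then show ?thesis by (simp add: prior_cyl_def)
qed

text \<open>This unfolds what it means that \<open>\<sigma>\<close> is winning for the plays that occur here. The cell
  recorded at the last stage does not enter the hypotheses, so the lemma also applies when that
  stage has been answered by II but its cell has not been chosen yet. An answer is open only in the intersection
  of the earlier ones; it is open in \<open>X\<close> because it is contained in the open set offered by I.\<close>

lemma play:
  assumes D: "ofilter \<kappa> D"
    and h: "\<And>\<alpha>. \<alpha> \<in> D \<Longrightarrow> pt (h \<alpha>) \<in> prior_cell h \<alpha> \<and> ans (h \<alpha>) = reply h \<alpha> (pt (h \<alpha>)) \<and>
      openin X (prior_cell h \<alpha>) \<and> prior_cell h \<alpha> \<subseteq> moves_Inter X (\<lambda>\<beta>. ans (h \<beta>)) (underS \<kappa> \<alpha>)"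
  shows "\<And>\<alpha>. \<alpha> \<in> D \<Longrightarrow>
      openin X (ans (h \<alpha>)) \<and> pt (h \<alpha>) \<in> ans (h \<alpha>) \<and> ans (h \<alpha>) \<subseteq> prior_cell h \<alpha>"
    and "limit_ordinal \<kappa> D \<Longrightarrow> moves_Inter X (\<lambda>\<beta>. ans (h \<beta>)) D \<noteq> {}"
proof -
  let ?V = "\<lambda>\<beta>. ans (h \<beta>)" and ?x = "\<lambda>\<beta>. pt (h \<beta>)"
  have "legal_I \<kappa> X (prior_cell h) ?x ?V \<alpha> \<and> follows \<kappa> \<sigma> (prior_cell h) ?x ?V \<alpha>" if \<alpha>: "\<alpha> \<in> D" for \<alpha>
  proof
    show "legal_I \<kappa> X (prior_cell h) ?x ?V \<alpha>"
      unfolding legal_I_def using h[OF \<alpha>] by (auto simp: openin_subtopology)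
    show "follows \<kappa> \<sigma> (prior_cell h) ?x ?V \<alpha>"
      unfolding follows_def using h[OF \<alpha>] by (simp add: reply_def fun_upd_idem)
  qed
  then have win: "(\<forall>\<alpha>\<in>D. legal_II \<kappa> X (prior_cell h) ?x ?V \<alpha>) \<and> (limit_ordinal \<kappa> D \<longrightarrow> moves_Inter X ?V D \<noteq> {})"
    using winning D unfolding winning_strategy_II_def by blast
  then show "limit_ordinal \<kappa> D \<Longrightarrow> moves_Inter X ?V D \<noteq> {}" by blast
  show "openin X (ans (h \<alpha>)) \<and> pt (h \<alpha>) \<in> ans (h \<alpha>) \<and> ans (h \<alpha>) \<subseteq> prior_cell h \<alpha>" if \<alpha>: "\<alpha> \<in> D" for \<alpha>
  proof -
    have l: "openin (subtopology X (moves_Inter X ?V (underS \<kappa> \<alpha>))) (ans (h \<alpha>))"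
        "pt (h \<alpha>) \<in> ans (h \<alpha>)" "ans (h \<alpha>) \<subseteq> prior_cell h \<alpha>"
      using win \<alpha> by (auto simp: legal_II_def)
    obtain T where T: "openin X T" "ans (h \<alpha>) = T \<inter> moves_Inter X ?V (underS \<kappa> \<alpha>)"
      using l(1) by (auto simp: openin_subtopology)
    have "ans (h \<alpha>) = T \<inter> prior_cell h \<alpha>" using T(2) l(3) h[OF \<alpha>] by blast
    then have "openin X (ans (h \<alpha>))" using T(1) h[OF \<alpha>] by auto
    then show ?thesis using l by blast
  qed
qed

lemma history_play:
  assumes "history D h" "\<alpha> \<in> D"
  shows "pt (h \<alpha>) \<in> prior_cell h \<alpha> \<and> ans (h \<alpha>) = reply h \<alpha> (pt (h \<alpha>)) \<and>
      openin X (prior_cell h \<alpha>) \<and> prior_cell h \<alpha> \<subseteq> moves_Inter X (\<lambda>\<beta>. ans (h \<beta>)) (underS \<kappa> \<alpha>)"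
proof -
  have "cell (h \<beta>) \<subseteq> ans (h \<beta>)" if "\<beta> \<in> underS \<kappa> \<alpha>" for \<beta>
    using cell_subset_ans[OF history_node[OF history_sub[OF assms] that]] .
  then have "prior_cell h \<alpha> \<subseteq> moves_Inter X (\<lambda>\<beta>. ans (h \<beta>)) (underS \<kappa> \<alpha>)"
    by (auto simp: prior_cell_def moves_Inter_def)
  then show ?thesis
    using history_node[OF assms] prior_cell_clopen(1)[OF history_sub[OF assms] history_Field[OF assms]]
    by (simp add: node_ok_def)
qed

text \<open>The play recorded by \<open>h\<close> is prolonged by one round in which I plays \<open>x\<close>. The cell and the
  cylinder of the new stage do not exist yet, so dummy values are recorded for them.\<close>

lemma reply_legal:
  assumes hist: "history (underS \<kappa> \<alpha>) h" and \<alpha>: "\<alpha> \<in> Field \<kappa>" and x: "x \<in> prior_cell h \<alpha>"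
  shows "openin X (reply h \<alpha> x) \<and> x \<in> reply h \<alpha> x \<and> reply h \<alpha> x \<subseteq> prior_cell h \<alpha>"
proof -
  define h' where "h' = h(\<alpha> := Node x (reply h \<alpha> x) {} {})"
  have eq: "h' \<beta> = h \<beta>" if "\<beta> \<in> underS \<kappa> \<alpha>" for \<beta> using that underS_irrefl by (auto simp: h'_def)
  have pc: "prior_cell h' \<alpha> = prior_cell h \<alpha>" "reply h' \<alpha> y = reply h \<alpha> y" for y
    using prior_cell_cong[of \<alpha> h' h] reply_cong[of \<alpha> h' h] eq by auto
  have hist': "history (underS \<kappa> \<alpha>) h'"
    unfolding history_def
  proof (intro conjI ballI ofilter_underS)
    fix \<beta> assume \<beta>: "\<beta> \<in> underS \<kappa> \<alpha>"
    have "node_ok h' \<beta> = node_ok h \<beta>"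
      by (rule node_ok_cong) (use eq \<beta> underS_trans in blast)+
    then show "node_ok h' \<beta>" using history_node[OF hist \<beta>] by simp
  qed
  have "pt (h' \<gamma>) \<in> prior_cell h' \<gamma> \<and> ans (h' \<gamma>) = reply h' \<gamma> (pt (h' \<gamma>)) \<and>
      openin X (prior_cell h' \<gamma>) \<and> prior_cell h' \<gamma> \<subseteq> moves_Inter X (\<lambda>\<beta>. ans (h' \<beta>)) (underS \<kappa> \<gamma>)"
    if "\<gamma> \<in> under \<kappa> \<alpha>" for \<gamma>
  proof (cases "\<gamma> = \<alpha>")
    case True
    have "cell (h' \<beta>) \<subseteq> ans (h' \<beta>)" if "\<beta> \<in> underS \<kappa> \<alpha>" for \<beta>
      using cell_subset_ans[OF history_node[OF hist' that]] .
    then have "prior_cell h' \<alpha> \<subseteq> moves_Inter X (\<lambda>\<beta>. ans (h' \<beta>)) (underS \<kappa> \<alpha>)"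
      by (auto simp: prior_cell_def moves_Inter_def)
    then show ?thesis
      using True x pc prior_cell_clopen(1)[OF hist \<alpha>] by (simp add: h'_def)
  next
    case False
    then show ?thesis using history_play[OF hist'] under_cases[OF that] by blast
  qed
  from play(1)[OF ofilter_under this, of \<alpha> \<alpha>]
  have "openin X (ans (h' \<alpha>)) \<and> pt (h' \<alpha>) \<in> ans (h' \<alpha>) \<and> ans (h' \<alpha>) \<subseteq> prior_cell h' \<alpha>"
    using under_eq[OF \<alpha>] by simp
  then show ?thesis using pc by (simp add: h'_def)
qed

text \<open>Each cell is contained in the answer of its own round, and that answer in all earlier cells. At a
  limit the cells therefore have the same intersection as the answers, which is nonempty since
  \<open>\<sigma>\<close> is winning. If there is a last stage, its cell lies in all the others.\<close>

lemma history_cells_meet: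
  assumes hist: "history D h"
  shows "topspace X \<inter> (\<Inter>\<beta>\<in>D. cell (h \<beta>)) \<noteq> {}"
proof -
  consider "D = {}" | "limit_ordinal \<kappa> D" | \<delta> where "\<delta> \<in> D" "\<And>\<beta>. \<beta> \<in> D \<Longrightarrow> \<delta> \<notin> underS \<kappa> \<beta>"
    using hist unfolding limit_ordinal_def history_def by blast
  then show ?thesis
  proof cases
    case 1
    then show ?thesis using nonempty by simp
  next
    case 2
    have D: "ofilter \<kappa> D" using hist by (simp add: history_def)
    have "moves_Inter X (\<lambda>\<beta>. ans (h \<beta>)) D \<subseteq> topspace X \<inter> (\<Inter>\<beta>\<in>D. cell (h \<beta>))"
    proof (intro subsetI IntI INT_I)
      fix y \<beta> assume y: "y \<in> moves_Inter X (\<lambda>\<beta>. ans (h \<beta>)) D" and \<beta>: "\<beta> \<in> D"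
      obtain \<gamma> where \<gamma>: "\<gamma> \<in> D" "\<beta> \<in> underS \<kappa> \<gamma>" using 2 \<beta> by (auto simp: limit_ordinal_def)
      have "y \<in> ans (h \<gamma>)" using y \<gamma>(1) by (simp add: moves_Inter_def)
      then have "y \<in> prior_cell h \<gamma>" using play(1)[OF D history_play[OF hist] \<gamma>(1)] by blast
      then show "y \<in> cell (h \<beta>)" using \<gamma>(2) by (simp add: prior_cell_def)
    qed (simp add: moves_Inter_def)
    then show ?thesis using play(2)[OF D history_play[OF hist] 2] by blast
  next
    case 3
    have ok: "node_ok h \<delta>" using history_node[OF hist 3(1)] .
    then obtain y where y: "y \<in> cell (h \<delta>)" "y \<in> topspace X"
      by (auto simp: node_ok_def prior_cell_def)
    have "y \<in> cell (h \<beta>)" if \<beta>: "\<beta> \<in> D" for \<beta>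
      using underS_cases[OF history_Field[OF hist \<beta>] history_Field[OF hist 3(1)]] 3(2)[OF \<beta>]
        y(1) cell_antimono[OF ok] by blast
    then show ?thesis using y(2) by blast
  qed
qed

text \<open>\<open>\<Psi>\<close> assigns to each point of the prior cell the node at stage \<open>\<alpha>\<close> to which it belongs. Points
  have the same node as soon as they share its cell or the cylinders of their nodes meet: cells and
  cylinders of the nodes are thus two partitions, of the prior cell and of the prior cylinder, in
  bijection with each other.\<close>

definition splits :: "('k \<Rightarrow> ('k, 'a) node) \<Rightarrow> 'k \<Rightarrow> ('a \<Rightarrow> ('k, 'a) node) \<Rightarrow> bool" where
  "splits h \<alpha> \<Psi> \<longleftrightarrow>
     (\<forall>y\<in>prior_cell h \<alpha>. node_ok (h(\<alpha> := \<Psi> y)) \<alpha> \<and> y \<in> cell (\<Psi> y)) \<and>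
     (\<forall>y\<in>prior_cell h \<alpha>. \<forall>z\<in>prior_cell h \<alpha>.
        z \<in> cell (\<Psi> y) \<or> cyl (\<Psi> y) \<inter> cyl (\<Psi> z) \<noteq> {} \<longrightarrow> \<Psi> z = \<Psi> y) \<and>
     prior_cyl h \<alpha> \<subseteq> (\<Union>y\<in>prior_cell h \<alpha>. cyl (\<Psi> y))"

lemma splits_cong:
  assumes "\<And>\<beta>. \<beta> \<in> underS \<kappa> \<alpha> \<Longrightarrow> h \<beta> = h' \<beta>"
  shows "splits h \<alpha> = splits h' \<alpha>"
proof
  fix \<Psi> :: "'a \<Rightarrow> ('k, 'a) node"
  have 1: "prior_cell h \<alpha> = prior_cell h' \<alpha>" by (rule prior_cell_cong) (rule assms)
  have 2: "prior_cyl h \<alpha> = prior_cyl h' \<alpha>" by (rule prior_cyl_cong) (rule assms)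
  have "node_ok (h(\<alpha> := \<Psi> y)) \<alpha> = node_ok (h'(\<alpha> := \<Psi> y)) \<alpha>" for y
    by (rule node_ok_cong) (use assms in auto)
  then show "splits h \<alpha> \<Psi> = splits h' \<alpha> \<Psi>"
    unfolding splits_def 1 2 by simp
qed

lemma splits_exists:
  assumes hist: "history (underS \<kappa> \<alpha>) h" and \<alpha>: "\<alpha> \<in> Field \<kappa>" and ne: "prior_cell h \<alpha> \<noteq> {}"
  shows "\<exists>\<Psi>. splits h \<alpha> \<Psi>"
proof -
  let ?C = "prior_cell h \<alpha>"
  define G where "G x = reply h \<alpha> x \<inter> (if x \<in> B \<alpha> then B \<alpha> else topspace X - B \<alpha>)" for x
  have C_sub: "?C \<subseteq> topspace X" by (auto simp: prior_cell_def)
  have G: "openin X (G x) \<and> x \<in> G x" if x: "x \<in> ?C" for x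
    using reply_legal[OF hist \<alpha> x] B_open[of \<alpha>] B_closed[of \<alpha>] x C_sub by (auto simp: G_def)
  show ?thesis
  proof (rule small_clopen_partition_nontrivial[OF reg haus add Lind prior_cell_clopen[OF hist \<alpha>] ne perf G])
    fix P
    assume P: "|P| <o \<kappa>" "\<Union>P = ?C" "{} \<notin> P" "\<And>A. A \<in> P \<Longrightarrow> openin X A" "\<And>A. A \<in> P \<Longrightarrow> closedin X A"
      "\<And>A. A \<in> P \<Longrightarrow> \<exists>x\<in>?C. A \<subseteq> G x"
      "\<And>A B. A \<in> P \<Longrightarrow> B \<in> P \<Longrightarrow> A \<inter> B \<noteq> {} \<Longrightarrow> A = B" "\<exists>A\<in>P. \<exists>B\<in>P. A \<noteq> B"
    obtain A1 A2 where A12: "A1 \<in> P" "A2 \<in> P" "A1 \<noteq> A2" using P(8) by auto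
    have agree: "v i = w i" if "i \<in> underS \<kappa> \<alpha>" "v \<in> prior_cyl h \<alpha>" "w \<in> prior_cyl h \<alpha>" for i v w
    proof -
      have "v \<in> cyl (h i)" "w \<in> cyl (h i)" using that by (auto simp: prior_cyl_def)
      then show ?thesis using history_node[OF hist that(1)] by (simp add: node_ok_def)
    qed
    obtain q where q: "\<And>A. A \<in> P \<Longrightarrow> q A \<in> ?C \<and> A \<subseteq> G (q A)" using P(6) by metis
    define piece where "piece y = (SOME A. A \<in> P \<and> y \<in> A)" for y
    have piece: "piece y \<in> P \<and> y \<in> piece y" if "y \<in> ?C" for y
      unfolding piece_def by (rule someI_ex) (use that P(2) in blast)
    have piece_eq: "piece y = A" if "A \<in> P" "y \<in> A" for y A
      using piece[of y] P(7)[of "piece y" A] P(2) that by blast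
    show ?thesis
    proof (rule cylinder_split[of "prior_cyl h \<alpha>" P A1 A2 \<alpha>, OF prior_cyl_cylinder[OF hist \<alpha>] P(1) A12 \<alpha>])
      show "v i = w i" if "i \<in> underS \<kappa> \<alpha>" "v \<in> prior_cyl h \<alpha>" "w \<in> prior_cyl h \<alpha>" for i v w
        by (rule agree[OF that])
    next
      fix M
      assume M: "\<And>A. A \<in> P \<Longrightarrow> M A \<in> cylinders \<kappa>" "(\<Union>A\<in>P. M A) = prior_cyl h \<alpha>"
        "\<And>A A'. A \<in> P \<Longrightarrow> A' \<in> P \<Longrightarrow> M A \<inter> M A' \<noteq> {} \<Longrightarrow> A = A'"
        "\<And>A v w. A \<in> P \<Longrightarrow> v \<in> M A \<Longrightarrow> w \<in> M A \<Longrightarrow> v \<alpha> = w \<alpha>"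
      define N where "N A = Node (q A) (reply h \<alpha> (q A)) A (M A)" for A
      have ok: "node_ok (h(\<alpha> := N A)) \<alpha>" if A: "A \<in> P" for A
      proof -
        let ?h = "h(\<alpha> := N A)"
        have eq: "?h \<beta> = h \<beta>" if "\<beta> \<in> underS \<kappa> \<alpha>" for \<beta> using that underS_irrefl by auto
        have "A \<subseteq> reply h \<alpha> (q A) \<and> (A \<subseteq> B \<alpha> \<or> A \<inter> B \<alpha> = {})"
          using q[OF A] by (auto simp: G_def split: if_splits)
        moreover have "A \<noteq> {}" "A \<subseteq> ?C" using P(2,3) A by auto
        moreover have "M A \<subseteq> prior_cyl h \<alpha>" using M(2) A by blast
        ultimately show ?thesis
          using q[OF A] P(4,5)[OF A] M(1)[OF A] M(4)[OF A] prior_cell_cong[of \<alpha> ?h h] eq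
            prior_cyl_cong[of \<alpha> ?h h] reply_cong[of \<alpha> ?h h]
          unfolding node_ok_def by (simp add: N_def)
      qed
      have "splits h \<alpha> (\<lambda>y. N (piece y))"
        unfolding splits_def
      proof (intro conjI ballI impI)
        fix y assume y: "y \<in> ?C"
        show "node_ok (h(\<alpha> := N (piece y))) \<alpha>" using ok piece[OF y] by blast
        show "y \<in> cell (N (piece y))" using piece[OF y] by (simp add: N_def)
        fix z assume z: "z \<in> ?C"
        assume "z \<in> cell (N (piece y)) \<or> cyl (N (piece y)) \<inter> cyl (N (piece z)) \<noteq> {}"
        then have "piece y = piece z"
        proof
          assume "z \<in> cell (N (piece y))"
          then show ?thesis using piece_eq[of "piece y" z] piece[OF y] by (simp add: N_def)
        next
          assume "cyl (N (piece y)) \<inter> cyl (N (piece z)) \<noteq> {}"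
          then show ?thesis using M(3) piece[OF y] piece[OF z] by (simp add: N_def)
        qed
        then show "N (piece z) = N (piece y)" by simp
      next
        show "prior_cyl h \<alpha> \<subseteq> (\<Union>y\<in>?C. cyl (N (piece y)))"
        proof
          fix w assume "w \<in> prior_cyl h \<alpha>"
          then obtain A where A: "A \<in> P" "w \<in> M A" using M(2) by blast
          then obtain y where y: "y \<in> A" using P(3) by (metis all_not_in_conv)
          then have "y \<in> ?C" using P(2) A(1) by blast
          moreover have "w \<in> cyl (N (piece y))" using piece_eq[OF A(1) y] A(2) by (simp add: N_def)
          ultimately show "w \<in> (\<Union>y\<in>?C. cyl (N (piece y)))" by blast
        qed
      qed
      then show ?thesis by blast
    qed
  qed
qed

definition split :: "('k \<Rightarrow> ('k, 'a) node) \<Rightarrow> 'k \<Rightarrow> 'a \<Rightarrow> ('k, 'a) node" where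
  "split h \<alpha> = (SOME \<Psi>. splits h \<alpha> \<Psi>)"

lemma split_cong: "(\<And>\<beta>. \<beta> \<in> underS \<kappa> \<alpha> \<Longrightarrow> h \<beta> = h' \<beta>) \<Longrightarrow> split h \<alpha> = split h' \<alpha>"
  unfolding split_def using splits_cong[of \<alpha> h h'] by simp

text \<open>The nodes through which a point \<open>y\<close> passes, by recursion on the stage. The choice hidden in
  \<open>split\<close> depends on the history alone and not on \<open>y\<close>, so points with the same history are sorted
  by the same split; this makes the chains of nodes of different points cohere into a tree.\<close>

definition nodes :: "'a \<Rightarrow> 'k \<Rightarrow> ('k, 'a) node" where
  "nodes y = wo_rel.worec \<kappa> (\<lambda>f \<alpha>. split (restrict f (underS \<kappa> \<alpha>)) \<alpha> y)"

lemma nodes_eq: "nodes y \<alpha> = split (nodes y) \<alpha> y"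
proof -
  let ?H = "\<lambda>f \<alpha>. split (restrict f (underS \<kappa> \<alpha>)) \<alpha> y"
  have "wo_rel.adm_wo \<kappa> ?H"
    unfolding wo_rel.adm_wo_def[OF wo]
  proof (intro allI impI)
    fix f g :: "'k \<Rightarrow> ('k, 'a) node" and \<alpha>
    assume "\<forall>\<beta>\<in>underS \<kappa> \<alpha>. f \<beta> = g \<beta>"
    then have "restrict f (underS \<kappa> \<alpha>) = restrict g (underS \<kappa> \<alpha>)" by (auto simp: restrict_def)
    then show "?H f \<alpha> = ?H g \<alpha>" by simp
  qed
  then have "nodes y = ?H (nodes y)"
    unfolding nodes_def by (rule wo_rel.worec_fixpoint[OF wo])
  then have "nodes y \<alpha> = split (restrict (nodes y) (underS \<kappa> \<alpha>)) \<alpha> y" by (rule fun_cong)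
  also have "split (restrict (nodes y) (underS \<kappa> \<alpha>)) \<alpha> = split (nodes y) \<alpha>"
    by (rule split_cong) simp
  finally show ?thesis .
qed

lemma nodes_step:
  assumes "history (underS \<kappa> \<alpha>) (nodes y)" "\<alpha> \<in> Field \<kappa>" "y \<in> prior_cell (nodes y) \<alpha>"
  shows "splits (nodes y) \<alpha> (split (nodes y) \<alpha>)" "node_ok (nodes y) \<alpha>" "y \<in> cell (nodes y \<alpha>)"
proof -
  have "\<exists>\<Psi>. splits (nodes y) \<alpha> \<Psi>" using splits_exists[OF assms(1,2)] assms(3) by blast
  then show *: "splits (nodes y) \<alpha> (split (nodes y) \<alpha>)"
    unfolding split_def by (rule someI_ex)
  have "(nodes y)(\<alpha> := split (nodes y) \<alpha> y) = nodes y" using nodes_eq[of y \<alpha>] by (simp add: fun_upd_idem)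
  then show "node_ok (nodes y) \<alpha>" "y \<in> cell (nodes y \<alpha>)"
    using * assms(3) nodes_eq[of y \<alpha>] unfolding splits_def by metis+
qed

lemma nodes_ok:
  assumes "y \<in> topspace X" "\<alpha> \<in> Field \<kappa>"
  shows "node_ok (nodes y) \<alpha> \<and> y \<in> cell (nodes y \<alpha>)"
  using assms(2)
proof (induction rule: ordinal_induct)
  case (less \<alpha>)
  have "history (underS \<kappa> \<alpha>) (nodes y)" using less.IH by (simp add: history_def ofilter_underS)
  moreover have "y \<in> prior_cell (nodes y) \<alpha>" using less.IH assms(1) by (simp add: prior_cell_def)
  ultimately show ?case using nodes_step less.hyps by blast
qed

lemma nodes_history: "y \<in> topspace X \<Longrightarrow> ofilter \<kappa> D \<Longrightarrow> history D (nodes y)"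
  using nodes_ok by (auto simp: history_def ofilter_def)

lemma nodes_prior: "y \<in> topspace X \<Longrightarrow> y \<in> prior_cell (nodes y) \<alpha>"
  using nodes_ok underS_Field by (auto simp: prior_cell_def)

lemma nodes_splits:
  "y \<in> topspace X \<Longrightarrow> \<alpha> \<in> Field \<kappa> \<Longrightarrow> splits (nodes y) \<alpha> (split (nodes y) \<alpha>)"
  by (rule nodes_step(1)) (simp_all add: nodes_history ofilter_underS nodes_prior)

text \<open>By induction on \<open>\<alpha>\<close>: meeting at stage \<open>\<alpha>\<close> implies meeting at every earlier stage, since cells
  and cylinders decrease. So the two histories agree, both points are sorted by the same split, and
  this split separates points with different nodes.\<close>

lemma nodes_determined:
  assumes y: "y \<in> topspace X" and z: "z \<in> topspace X" and \<alpha>: "\<alpha> \<in> Field \<kappa>"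
    and meet: "z \<in> cell (nodes y \<alpha>) \<or> cyl (nodes y \<alpha>) \<inter> cyl (nodes z \<alpha>) \<noteq> {}"
  shows "nodes z \<alpha> = nodes y \<alpha>"
proof -
  have "z \<in> cell (nodes y \<alpha>) \<or> cyl (nodes y \<alpha>) \<inter> cyl (nodes z \<alpha>) \<noteq> {} \<longrightarrow> nodes z \<alpha> = nodes y \<alpha>"
    using \<alpha>
  proof (induction rule: ordinal_induct)
    case (less \<alpha>)
    show ?case
    proof
      assume meet: "z \<in> cell (nodes y \<alpha>) \<or> cyl (nodes y \<alpha>) \<inter> cyl (nodes z \<alpha>) \<noteq> {}"
      have ok: "node_ok (nodes y) \<alpha>" "node_ok (nodes z) \<alpha>" using nodes_ok y z less.hyps by auto
      have eq: "nodes z \<beta> = nodes y \<beta>" if \<beta>: "\<beta> \<in> underS \<kappa> \<alpha>" for \<beta>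
      proof -
        have "z \<in> cell (nodes y \<beta>) \<or> cyl (nodes y \<beta>) \<inter> cyl (nodes z \<beta>) \<noteq> {}"
          using meet cell_antimono[OF ok(1) \<beta>] cyl_antimono[OF ok(1) \<beta>] cyl_antimono[OF ok(2) \<beta>] by blast
        then show ?thesis using less.IH[OF \<beta>] by blast
      qed
      have "split (nodes z) \<alpha> = split (nodes y) \<alpha>" by (rule split_cong) (rule eq)
      then have nz: "nodes z \<alpha> = split (nodes y) \<alpha> z" using nodes_eq[of z \<alpha>] by simp
      have "prior_cell (nodes z) \<alpha> = prior_cell (nodes y) \<alpha>" by (rule prior_cell_cong) (rule eq)
      then have "z \<in> prior_cell (nodes y) \<alpha>" using nodes_prior[OF z, of \<alpha>] by simp
      then show "nodes z \<alpha> = nodes y \<alpha>"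
        using nodes_splits[OF y less.hyps] nodes_prior[OF y, of \<alpha>] meet nodes_eq[of y \<alpha>] nz
        unfolding splits_def by metis
    qed
  qed
  then show ?thesis using meet by blast
qed

section \<open>The homeomorphism\<close>

text \<open>The nodes whose cylinders contain \<open>w\<close> form a history, because two such nodes at the same stage
  have meeting cylinders and are therefore equal. The cells of this history have a common point,
  and every common point passes through exactly these nodes.\<close>

lemma glue_points:
  assumes D: "ofilter \<kappa> D" and w: "w \<in> points"
    and ex: "\<And>\<beta>. \<beta> \<in> D \<Longrightarrow> \<exists>y\<in>topspace X. w \<in> cyl (nodes y \<beta>)"
  shows "\<exists>y\<in>topspace X. \<forall>\<beta>\<in>D. w \<in> cyl (nodes y \<beta>)"
proof -
  obtain p where p: "\<And>\<beta>. \<beta> \<in> D \<Longrightarrow> p \<beta> \<in> topspace X" "\<And>\<beta>. \<beta> \<in> D \<Longrightarrow> w \<in> cyl (nodes (p \<beta>) \<beta>)"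
    using ex by metis
  define h where "h \<beta> = nodes (p \<beta>) \<beta>" for \<beta>
  have D_Field: "\<beta> \<in> Field \<kappa>" if "\<beta> \<in> D" for \<beta> using D that by (auto simp: ofilter_def)
  have eq: "nodes (p \<beta>) \<gamma> = h \<gamma>" if \<beta>: "\<beta> \<in> D" and \<gamma>: "\<gamma> \<in> underS \<kappa> \<beta>" for \<beta> \<gamma>
  proof -
    have "\<gamma> \<in> D" using ofilter_closed[OF D \<beta> \<gamma>] .
    moreover have "w \<in> cyl (nodes (p \<beta>) \<gamma>)"
      using p(2)[OF \<beta>] cyl_antimono nodes_ok p(1)[OF \<beta>] D_Field[OF \<beta>] \<gamma> by blast
    ultimately show ?thesis
      using nodes_determined[of "p \<gamma>" "p \<beta>" \<gamma>] p \<beta> D_Field by (auto simp: h_def)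
  qed
  have "history D h"
    unfolding history_def
  proof (intro conjI ballI D)
    fix \<beta> assume \<beta>: "\<beta> \<in> D"
    have "node_ok h \<beta> = node_ok (nodes (p \<beta>)) \<beta>"
      by (rule node_ok_cong) (use eq[OF \<beta>] in \<open>simp_all add: h_def\<close>)
    then show "node_ok h \<beta>" using nodes_ok p(1)[OF \<beta>] D_Field[OF \<beta>] by simp
  qed
  from history_cells_meet[OF this] obtain y where y: "y \<in> topspace X" "\<And>\<beta>. \<beta> \<in> D \<Longrightarrow> y \<in> cell (h \<beta>)"
    by blast
  have "w \<in> cyl (nodes y \<beta>)" if \<beta>: "\<beta> \<in> D" for \<beta>
  proof -
    have "nodes y \<beta> = nodes (p \<beta>) \<beta>"
      using nodes_determined[OF p(1)[OF \<beta>] y(1) D_Field[OF \<beta>]] y(2)[OF \<beta>] by (simp add: h_def)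
    then show ?thesis using p(2)[OF \<beta>] by simp
  qed
  then show ?thesis using y(1) by blast
qed

text \<open>Given a point whose cylinders contain \<open>w\<close> at all stages below \<open>\<alpha>\<close>, the split at stage \<open>\<alpha>\<close>
  distributes the whole prior cylinder, so some point with the same history has a cylinder
  containing \<open>w\<close> at stage \<open>\<alpha>\<close> as well.\<close>

lemma cyl_covers:
  assumes w: "w \<in> points"
  shows "\<exists>y\<in>topspace X. \<forall>\<alpha>\<in>Field \<kappa>. w \<in> cyl (nodes y \<alpha>)"
proof (rule glue_points[OF ofilter_Field w])
  fix \<alpha> assume "\<alpha> \<in> Field \<kappa>"
  then show "\<exists>y\<in>topspace X. w \<in> cyl (nodes y \<alpha>)"
  proof (induction rule: ordinal_induct)
    case (less \<alpha>)
    obtain y where y: "y \<in> topspace X" "\<forall>\<beta>\<in>underS \<kappa> \<alpha>. w \<in> cyl (nodes y \<beta>)"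
      using glue_points[OF ofilter_underS w] less.IH by metis
    then have "w \<in> prior_cyl (nodes y) \<alpha>" using w by (simp add: prior_cyl_def)
    then obtain z where z: "z \<in> prior_cell (nodes y) \<alpha>" "w \<in> cyl (split (nodes y) \<alpha> z)"
      using nodes_splits[OF y(1) less.hyps] unfolding splits_def by blast
    have zX: "z \<in> topspace X" using z(1) by (simp add: prior_cell_def)
    have "nodes z \<beta> = nodes y \<beta>" if \<beta>: "\<beta> \<in> underS \<kappa> \<alpha>" for \<beta>
    proof (rule nodes_determined[OF y(1) zX])
      show "\<beta> \<in> Field \<kappa>" using \<beta> underS_Field by blast
      show "z \<in> cell (nodes y \<beta>) \<or> cyl (nodes y \<beta>) \<inter> cyl (nodes z \<beta>) \<noteq> {}"
        using \<beta> z(1) by (simp add: prior_cell_def)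
    qed
    then have "split (nodes z) \<alpha> = split (nodes y) \<alpha>" by (rule split_cong)
    then have "w \<in> cyl (nodes z \<alpha>)" using z(2) nodes_eq[of z \<alpha>] by simp
    then show ?case using zX by blast
  qed
qed

definition code :: "'a \<Rightarrow> ('k \<rightharpoonup> bool)" where
  "code y = (THE w. w \<in> points \<and> (\<forall>\<alpha>\<in>Field \<kappa>. w \<in> cyl (nodes y \<alpha>)))"

text \<open>All points of the cylinder at stage \<open>i\<close> have the same value at \<open>i\<close>, so there is at most one
  point in all the cylinders.\<close>

lemma code_eqI:
  assumes y: "y \<in> topspace X" and w: "w \<in> points" "\<And>\<alpha>. \<alpha> \<in> Field \<kappa> \<Longrightarrow> w \<in> cyl (nodes y \<alpha>)"
  shows "code y = w"
  unfolding code_def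
proof (rule the_equality)
  show "w \<in> points \<and> (\<forall>\<alpha>\<in>Field \<kappa>. w \<in> cyl (nodes y \<alpha>))" using w by blast
  fix v assume v: "v \<in> points \<and> (\<forall>\<alpha>\<in>Field \<kappa>. v \<in> cyl (nodes y \<alpha>))"
  show "v = w"
  proof
    fix i show "v i = w i"
    proof (cases "i \<in> Field \<kappa>")
      case True
      then show ?thesis using nodes_ok[OF y True] v w(2)[OF True] by (simp add: node_ok_def)
    next
      case False
      then show ?thesis using v w(1) by (metis domIff mem_sequences_UNIV)
    qed
  qed
qed

lemma code_mem:
  assumes y: "y \<in> topspace X"
  shows "code y \<in> points" "\<And>\<alpha>. \<alpha> \<in> Field \<kappa> \<Longrightarrow> code y \<in> cyl (nodes y \<alpha>)"
proof -
  obtain w where w: "w \<in> points" "\<And>\<alpha>. \<alpha> \<in> Field \<kappa> \<Longrightarrow> w \<in> cyl (nodes y \<alpha>)"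
    using history_point[OF nodes_history[OF y ofilter_Field]] by metis
  then show "code y \<in> points" "\<And>\<alpha>. \<alpha> \<in> Field \<kappa> \<Longrightarrow> code y \<in> cyl (nodes y \<alpha>)"
    using code_eqI[OF y w] by auto
qed

lemma code_in_cyl_iff:
  assumes y: "y \<in> topspace X" and z: "z \<in> topspace X" and \<alpha>: "\<alpha> \<in> Field \<kappa>"
  shows "code z \<in> cyl (nodes y \<alpha>) \<longleftrightarrow> z \<in> cell (nodes y \<alpha>)"
proof
  assume "code z \<in> cyl (nodes y \<alpha>)"
  then have "nodes z \<alpha> = nodes y \<alpha>"
    using nodes_determined[OF y z \<alpha>] code_mem(2)[OF z \<alpha>] by blast
  then show "z \<in> cell (nodes y \<alpha>)" using nodes_ok[OF z \<alpha>] by simp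
next
  assume "z \<in> cell (nodes y \<alpha>)"
  then have "nodes z \<alpha> = nodes y \<alpha>" using nodes_determined[OF y z \<alpha>] by blast
  then show "code z \<in> cyl (nodes y \<alpha>)" using code_mem(2)[OF z \<alpha>] by simp
qed

text \<open>The cell of \<open>y\<close> at stage \<open>\<alpha>\<close> is contained in \<open>B \<alpha>\<close> or disjoint from it, and it contains \<open>y\<close>.\<close>

lemma small_cell:
  assumes "openin X U" "y \<in> U"
  obtains \<alpha> where "\<alpha> \<in> Field \<kappa>" "cell (nodes y \<alpha>) \<subseteq> U"
proof -
  obtain \<alpha> where \<alpha>: "\<alpha> \<in> Field \<kappa>" "y \<in> B \<alpha>" "B \<alpha> \<subseteq> U" using B_base[OF assms] by blast
  have "y \<in> topspace X" using assms openin_subset by blast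
  then have "node_ok (nodes y) \<alpha>" "y \<in> cell (nodes y \<alpha>)" using nodes_ok \<alpha>(1) by auto
  then have "cell (nodes y \<alpha>) \<subseteq> B \<alpha>" using \<alpha>(2) by (auto simp: node_ok_def)
  then show ?thesis using that \<alpha> by blast
qed

text \<open>By \<open>code_in_cyl_iff\<close>, \<open>code\<close> maps the cell of a point at any stage onto the cylinder at that
  stage. Cells form a base of \<open>X\<close> by \<open>small_cell\<close>; the cylinders matched with them form
  a base of \<open>2\<^sup>\<kappa>\<close> because the stem at stage \<open>a\<close> has length at least \<open>a\<close>.\<close>

theorem homeomorphic_Cantor: "X homeomorphic_space generalized_Cantor \<kappa>"
proof -
  let ?Y = "generalized_Cantor \<kappa>"
  have surj: "\<exists>y\<in>topspace X. code y = w" if "w \<in> points" for w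
    using cyl_covers[OF that] code_eqI that by metis
  have image: "code ` topspace X = topspace ?Y"
    using surj code_mem(1) by (auto simp: topspace_Cantor)
  have inj: "inj_on code (topspace X)"
  proof (rule inj_onI, rule ccontr)
    fix y z assume yz: "y \<in> topspace X" "z \<in> topspace X" "code y = code z" "y \<noteq> z"
    then obtain U where U: "openin X U" "y \<in> U" "z \<notin> U"
      using haus by (metis Hausdorff_space_def disjnt_iff)
    obtain \<alpha> where \<alpha>: "\<alpha> \<in> Field \<kappa>" "cell (nodes y \<alpha>) \<subseteq> U" by (rule small_cell[OF U(1,2)])
    have "code z \<in> cyl (nodes y \<alpha>)" using code_mem(2)[OF yz(1) \<alpha>(1)] yz(3) by simp
    then show False using code_in_cyl_iff[OF yz(1,2) \<alpha>(1)] \<alpha>(2) U(3) by blast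
  qed
  have cont: "continuous_map X ?Y code"
    unfolding continuous_map
  proof (intro conjI allI impI)
    show "code ` topspace X \<subseteq> topspace ?Y" using image by simp
    fix U assume U: "openin ?Y U"
    show "openin X {y \<in> topspace X. code y \<in> U}"
    proof (subst openin_subopen, intro ballI)
      fix y assume "y \<in> {y \<in> topspace X. code y \<in> U}"
      then have y: "y \<in> topspace X" "code y \<in> U" by auto
      obtain N where N: "N \<in> cylinders \<kappa>" "code y \<in> N" "N \<subseteq> U" using U y(2) unfolding openin_Cantor by blast
      obtain a where a: "a \<in> Field \<kappa>" "N = cylinder \<kappa> (code y |` underS \<kappa> a)"
        by (rule cylinders_cases[OF N(1,2)])
      have ok: "node_ok (nodes y) a" "y \<in> cell (nodes y a)" using nodes_ok[OF y(1) a(1)] by auto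
      have sub: "cell (nodes y a) \<subseteq> topspace X" using ok(1) by (auto simp: node_ok_def prior_cell_def)
      have "code z \<in> U" if z: "z \<in> cell (nodes y a)" for z
      proof -
        have zX: "z \<in> topspace X" using sub z by blast
        have "code z i = code y i" if i: "i \<in> underS \<kappa> a" for i
        proof -
          have iF: "i \<in> Field \<kappa>" using i underS_Field by blast
          have "z \<in> cell (nodes y i)" using cell_antimono[OF ok(1) i] z by blast
          then have "code z \<in> cyl (nodes y i)" using code_in_cyl_iff[OF y(1) zX iF] by blast
          then show ?thesis using nodes_ok[OF y(1) iF] code_mem(2)[OF y(1) iF] by (simp add: node_ok_def)
        qed
        then have "code z \<in> N"
          unfolding a(2) mem_cylinder_restrict[OF code_mem(1)[OF y(1)]] using code_mem(1)[OF zX] by blast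
        then show ?thesis using N(3) by blast
      qed
      then show "\<exists>T. openin X T \<and> y \<in> T \<and> T \<subseteq> {y \<in> topspace X. code y \<in> U}"
        using ok sub by (intro exI[of _ "cell (nodes y a)"]) (auto simp: node_ok_def)
    qed
  qed
  have opn: "open_map X ?Y code"
    unfolding open_map_def
  proof (intro allI impI)
    fix U assume U: "openin X U"
    have "\<exists>N\<in>cylinders \<kappa>. w \<in> N \<and> N \<subseteq> code ` U" if "w \<in> code ` U" for w
    proof -
      obtain y where y: "y \<in> U" "w = code y" using \<open>w \<in> code ` U\<close> by blast
      have yX: "y \<in> topspace X" using y(1) U openin_subset by blast
      obtain \<alpha> where \<alpha>: "\<alpha> \<in> Field \<kappa>" "cell (nodes y \<alpha>) \<subseteq> U" by (rule small_cell[OF U y(1)])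
      have cyl: "cyl (nodes y \<alpha>) \<in> cylinders \<kappa>" using nodes_ok[OF yX \<alpha>(1)] by (simp add: node_ok_def)
      have "cyl (nodes y \<alpha>) \<subseteq> code ` U"
      proof
        fix v assume v: "v \<in> cyl (nodes y \<alpha>)"
        then have "v \<in> points" using cylinders_subset_points[OF cyl] by blast
        then obtain z where z: "z \<in> topspace X" "code z = v" using surj by blast
        then have "z \<in> cell (nodes y \<alpha>)" using code_in_cyl_iff[OF yX z(1) \<alpha>(1)] v by simp
        then show "v \<in> code ` U" using \<alpha>(2) z(2) by blast
      qed
      then show ?thesis using cyl code_mem(2)[OF yX \<alpha>(1)] y(2) by blast
    qed
    moreover have "code ` U \<subseteq> points" using code_mem(1) U openin_subset by fast
    ultimately show "openin ?Y (code ` U)" unfolding openin_Cantor by blast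
  qed
  show ?thesis
    using bijective_open_imp_homeomorphic_map[OF cont opn image inj] homeomorphic_map_imp_homeomorphic_space
    by blast
qed

end

theorem theorem3p14:
  fixes \<kappa> :: "'k rel"
  assumes "Card_order \<kappa>" and "natLeq <o \<kappa>" and "regularCard \<kappa>"
    and "|short_sequences \<kappa> (UNIV :: bool set)| =o \<kappa>"
    and "weakly_compact \<kappa>"
  shows "(regular_space (generalized_Cantor \<kappa>) \<and> Hausdorff_space (generalized_Cantor \<kappa>) \<and>
          topspace (generalized_Cantor \<kappa>) \<noteq> {} \<and>
          kappa_additive \<kappa> (generalized_Cantor \<kappa>) \<and>
          perfect_space (generalized_Cantor \<kappa>) \<and> kappa_perfect \<kappa> (generalized_Cantor \<kappa>) \<and>
          kappa_Lindelof \<kappa> (generalized_Cantor \<kappa>) \<and> SC_space \<kappa> (generalized_Cantor \<kappa>)) \<and>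
         (\<forall>X :: 'a topology.
            regular_space X \<and> Hausdorff_space X \<and> kappa_additive \<kappa> X \<longrightarrow>
            (perfect_space X \<longleftrightarrow> kappa_perfect \<kappa> X)) \<and>
         (\<forall>X :: 'a topology.
            regular_space X \<and> Hausdorff_space X \<and> topspace X \<noteq> {} \<and>
            kappa_additive \<kappa> X \<and> perfect_space X \<and> kappa_Lindelof \<kappa> X \<and> SC_space \<kappa> X \<longrightarrow>
            X homeomorphic_space generalized_Cantor \<kappa>)"
proof -
  interpret regular_cardinal \<kappa> using assms(1-3) by unfold_locales
  let ?Y = "generalized_Cantor \<kappa>"
  have "points \<noteq> {}" by (rule cylinder_nonempty[OF points_in_cylinders])
  then have "topspace ?Y \<noteq> {}" by (simp add: topspace_Cantor)
  moreover have "kappa_perfect \<kappa> ?Y"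
    using perfect_iff_kappa_perfect[OF additive_Cantor] perfect_Cantor by blast
  moreover have "SC_space \<kappa> ?Y"
    unfolding SC_space_def using weight_Cantor[OF assms(4)] strategy_Cantor by blast
  moreover have "X homeomorphic_space ?Y"
    if X: "regular_space X" "Hausdorff_space X" "topspace X \<noteq> {}" "kappa_additive \<kappa> X"
      "perfect_space X" "kappa_Lindelof \<kappa> X" "SC_space \<kappa> X" for X :: "'a topology"
  proof -
    obtain \<sigma> where \<sigma>: "winning_strategy_II \<kappa> X \<sigma>" using X(7) by (auto simp: SC_space_def)
    have "weight_at_most \<kappa> X" using X(7) by (simp add: SC_space_def)
    then show ?thesis
    proof (rule clopen_base[OF X(1,4)])
      fix B :: "'k \<Rightarrow> 'a set"
      assume B: "\<And>\<alpha>. openin X (B \<alpha>)" "\<And>\<alpha>. closedin X (B \<alpha>)"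
        "\<And>U x. openin X U \<Longrightarrow> x \<in> U \<Longrightarrow> \<exists>\<alpha>\<in>Field \<kappa>. x \<in> B \<alpha> \<and> B \<alpha> \<subseteq> U"
      interpret partition_tree \<kappa> X \<sigma> B
        by unfold_locales (use X \<sigma> B in blast)+
      show ?thesis by (rule homeomorphic_Cantor)
    qed
  qed
  ultimately show ?thesis
    using regular_Cantor Hausdorff_Cantor additive_Cantor perfect_Cantor Lindelof_Cantor[OF assms(5)]
      perfect_iff_kappa_perfect by blast
qed

end
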